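(* Let $X=\{x_1,\dots,x_n\}\subset(-\frac{\pi}{2},\frac{\pi}{2}]$ be a set of $n$ distinct nodes forming an $((h^{(j)},\nu^{(j)},n^{(j)})_{j=1}^M,\eta)$-clustered configuration with $h^{(1)}=\dots=h^{(M)}=\Delta:=\Delta(X)$. Put $s:=\max_j n^{(j)}$ and, for $m=1,\dots,s$, $\ell_m:=\#\{1\le k\le M: m\le n^{(k)}\}$. Then the $n$ singular values (counted with multiplicity) of the Vandermonde matrix $V_n=V(X;\{0,\dots,n-1\})$ split into $s$ groups $\{\sigma_{m,i}(V_n)\}_{i=1}^{\ell_m}$, $m=1,\dots,s$, which scale as follows: $$\{\sigma_{1,i}(V_n)\}_{i=1}^{\ell_1}\asymp\Delta^{0},\quad \{\sigma_{2,i}(V_n)\}_{i=1}^{\ell_2}\asymp\Delta^{1},\quad\dots,\quad\{\sigma_{s,i}(V_n)\}_{i=1}^{\ell_s}\asymp\Delta^{s-1}.$$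
   Context: For $x\in\mathbb{R}$, $\|x\|_{\mathbb{T}}:=|\arg(e^{\imath x})|=|x \bmod (-\pi,\pi]|$, where $\arg$ is the principal argument in $(-\pi,\pi]$. The minimal separation of $X$ is $\Delta(X):=\min_{i\ne j}\|x_i-x_j\|_{\mathbb{T}}$. A set $\mathcal{C}$ of $q$ nodes is an $(h,\nu,q)$-cluster if $h\le\|y-x\|_{\mathbb{T}}\le\nu h$ for all $x,y\in\mathcal{C}$ with $x\ne y$. The set $X$ forms an $((h^{(j)},\nu^{(j)},n^{(j)})_{j=1}^M,\eta)$-clustered configuration if there is a partition $X=\bigcup_{j=1}^M\mathcal{C}^{(j)}$ such that for each $j$: (1) $\mathcal{C}^{(j)}$ is an $(h^{(j)},\nu^{(j)},n^{(j)})$-cluster (so $|\mathcal{C}^{(j)}|=n^{(j)}$); (2) $\|x-y\|_{\mathbb{T}}\ge\eta>0$ for all $x\in\mathcal{C}^{(j)}$, $y\in X\setminus\mathcal{C}^{(j)}$. For a finite node set $X$ and a finite sampling set $S$, the Vandermonde matrix is $V(X;S)=[e^{\imath kx}]_{k\in S}^{x\in X}$ (rows indexed by $k\in S$, columns by $x\in X$). The symbol $\asymp$ denotes asymptotic scaling: $\{\sigma_{m,i}\}_i\asymp\Delta^{r}$ means that each element of the group is bounded above and below by positive constants times $\Delta^{r}$, the constants not depending on $\Delta$ (they may depend on $n$ and the other parameters of the configuration, such as $\eta$ and the $\nu^{(j)}$). *)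

theory Defs
  imports
    Complex_Main
    "HOL-Library.Disjoint_Sets"
    "Jordan_Normal_Form.Schur_Decomposition"
begin

definition torus_norm :: "real \<Rightarrow> real" where
  "torus_norm x = \<bar>Arg (exp (\<i> * complex_of_real x))\<bar>"

(* Unspecified (Min {}) when X has fewer than two elements. *)
definition min_separation :: "real set \<Rightarrow> real" where
  "min_separation X = Min {torus_norm (x - y) | x y. x \<in> X \<and> y \<in> X \<and> x \<noteq> y}"

definition is_cluster :: "real \<Rightarrow> real \<Rightarrow> nat \<Rightarrow> real set \<Rightarrow> bool" where
  "is_cluster h \<nu> q C \<longleftrightarrow>
     finite C \<and> card C = q \<and>
     (\<forall>x\<in>C. \<forall>y\<in>C. x \<noteq> y \<longrightarrow> h \<le> torus_norm (y - x) \<and> torus_norm (y - x) \<le> \<nu> * h)"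

(* Parameters h, nu, q are indexed by the cluster number j in {1..M};
   as blocks of a partition, the clusters are nonempty. *)
definition clustered_configuration ::
  "nat \<Rightarrow> (nat \<Rightarrow> real) \<Rightarrow> (nat \<Rightarrow> real) \<Rightarrow> (nat \<Rightarrow> nat) \<Rightarrow> real \<Rightarrow> real set \<Rightarrow> bool" where
  "clustered_configuration M h \<nu> q \<eta> X \<longleftrightarrow>
     \<eta> > 0 \<and>
     (\<exists>C. (\<Union>j\<in>{1..M}. C j) = X \<and> disjoint_family_on C {1..M} \<and>
        (\<forall>j\<in>{1..M}. C j \<noteq> {} \<and> is_cluster (h j) (\<nu> j) (q j) (C j) \<and>
           (\<forall>x\<in>C j. \<forall>y\<in>X - C j. torus_norm (x - y) \<ge> \<eta>)))"

(* Rows and columns are listed in increasing order of k in S and x in X; for finite S and X,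
   any other ordering gives the same matrix up to row and column permutations, hence the
   same singular values. *)
definition vandermonde :: "real set \<Rightarrow> int set \<Rightarrow> complex mat" where
  "vandermonde X S =
     mat (card S) (card X) (\<lambda>(i, j).
       exp (\<i> * of_int (sorted_list_of_set S ! i) * complex_of_real (sorted_list_of_set X ! j)))"

(* Square roots of the eigenvalues, with algebraic multiplicity, of A^* A.
   These eigenvalues are real and nonnegative, so Re only changes the type.
   The multiset has as many elements as A has columns. *)
definition singular_values :: "complex mat \<Rightarrow> real multiset" where
  "singular_values A =
     image_mset (\<lambda>z. sqrt (Re z)) (proots (char_poly (mat_adjoint A * A)))"

end

theory Submission
  imports Defs
begin

text \<open>
  Expanding each monomial at the nodes of each cluster in the Newton basis of that cluster
  factors the Vandermonde matrix as \<open>V = W D U\<close>. Here \<open>D\<close> is diagonal, its entry at a node being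
  the power of (a fixed multiple of) \<open>\<Delta>\<close> whose exponent is the number of earlier nodes in the same
  cluster; \<open>W\<close> holds divided differences and \<open>U\<close> the rescaled values of the Newton polynomials.
  The entries of \<open>W\<close> and \<open>U\<close> are bounded. Moreover \<open>U\<close> is triangular with diagonal at least \<open>1\<close> in
  modulus, and \<open>det W = det V / det (D U)\<close> is the product of the node differences between distinct
  clusters, hence bounded below in terms of \<open>\<eta>\<close>. So \<open>W\<close> and \<open>U\<close> have bounded inverses by Cramer's rule,
  and a Courant--Fischer argument makes the ordered singular values of \<open>V\<close> comparable to the ordered
  entries of \<open>D\<close>, among which \<open>\<Delta> ^ (m - 1)\<close> occurs once for every cluster with at least \<open>m\<close> nodes.
\<close>

subsection \<open>Unitary diagonalization of Hermitian matrices\<close>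

text \<open>Real-valued, because \<open>v \<bullet>c v\<close> has type \<open>complex\<close> and
  the estimates below use the order of the reals.\<close>

definition sq_norm2 :: "complex vec \<Rightarrow> real" where
  "sq_norm2 v = (\<Sum>i<dim_vec v. (cmod (v $ i))\<^sup>2)"

lemma cscalar_prod_self: "v \<bullet>c v = complex_of_real (sq_norm2 v)"
  by (simp add: sq_norm2_def scalar_prod_def atLeast0LessThan complex_norm_square del: of_real_power)

lemma sq_norm2_carrier: "v \<in> carrier_vec n \<Longrightarrow> sq_norm2 v = (\<Sum>i<n. (cmod (v $ i))\<^sup>2)"
  by (auto simp: sq_norm2_def)

lemma sq_norm2_nonneg [simp]: "sq_norm2 v \<ge> 0"
  by (simp add: sq_norm2_def sum_nonneg)

lemma sq_norm2_pos:
  assumes "v \<in> carrier_vec n" "v \<noteq> 0\<^sub>v n"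
  shows "sq_norm2 v > 0"
proof -
  have "sq_norm2 v \<noteq> 0"
    using assms conjugate_square_eq_0_vec[OF assms(1)] by (simp add: cscalar_prod_self)
  thus ?thesis using sq_norm2_nonneg[of v] by linarith
qed

lemma mat_adjoint_dim [simp]:
  "dim_row (mat_adjoint A) = dim_col A" "dim_col (mat_adjoint A) = dim_row A"
  by (simp_all add: mat_adjoint_def)

lemma mat_adjoint_index [simp]:
  "i < dim_col A \<Longrightarrow> j < dim_row A \<Longrightarrow> mat_adjoint A $$ (i, j) = conjugate (A $$ (j, i))"
  by (simp add: mat_adjoint_def mat_of_rows_index)

lemma mat_adjoint_carrier [simp]: "A \<in> carrier_mat n m \<Longrightarrow> mat_adjoint A \<in> carrier_mat m n"
  by (auto intro: carrier_matI)

lemma mat_adjoint_mat_adjoint [simp]: "mat_adjoint (mat_adjoint A) = A"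
  by (intro eq_matI) simp_all

lemma mat_adjoint_mult:
  fixes A B :: "complex mat"
  assumes "A \<in> carrier_mat n m" "B \<in> carrier_mat m k"
  shows "mat_adjoint (A * B) = mat_adjoint B * mat_adjoint A"
  using assms
  by (intro eq_matI) (auto simp: scalar_prod_def mult.commute intro!: sum.cong)

text \<open>Moving \<open>A\<close> across the inner product is an exchange of two sums. The
  identity makes a matrix with \<open>mat_adjoint P * P = 1\<^sub>m n\<close> an isometry and turns
  eigenvalues of a Gram matrix into lengths of image vectors.\<close>

lemma sq_norm2_mult_mat_vec:
  assumes A: "A \<in> carrier_mat m n" and v: "v \<in> carrier_vec n"
  shows "complex_of_real (sq_norm2 (A *\<^sub>v v)) = ((mat_adjoint A * A) *\<^sub>v v) \<bullet>c v"
proof -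
  have "((mat_adjoint A * A) *\<^sub>v v) \<bullet>c v = (mat_adjoint A *\<^sub>v (A *\<^sub>v v)) \<bullet>c v"
    using A v by (subst assoc_mult_mat_vec[of _ n m _ n]) auto
  also have "\<dots> = (\<Sum>i<n. (\<Sum>j<m. cnj (A $$ (j, i)) * (A *\<^sub>v v) $ j) * cnj (v $ i))"
    using A v by (simp add: scalar_prod_def atLeast0LessThan)
  also have "\<dots> = (\<Sum>i<n. \<Sum>j<m. (A *\<^sub>v v) $ j * cnj (A $$ (j, i) * v $ i))"
    by (simp add: sum_distrib_right sum_distrib_left mult_ac)
  also have "\<dots> = (\<Sum>j<m. \<Sum>i<n. (A *\<^sub>v v) $ j * cnj (A $$ (j, i) * v $ i))"
    by (rule sum.swap)
  also have "\<dots> = (\<Sum>j<m. (A *\<^sub>v v) $ j * cnj ((A *\<^sub>v v) $ j))"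
    using A v by (simp add: scalar_prod_def atLeast0LessThan sum_distrib_left)
  also have "\<dots> = (A *\<^sub>v v) \<bullet>c (A *\<^sub>v v)"
    using A v by (simp add: scalar_prod_def atLeast0LessThan)
  finally show ?thesis by (simp add: cscalar_prod_self)
qed

text \<open>Basis completion and Gram-Schmidt both keep \<open>v\<close> in front, and normalizing
  it produces the factor \<open>c\<close>. Such a \<open>W\<close> splits off one eigenvector in the
  diagonalization below.\<close>

lemma exists_unitary_first_col:
  fixes v :: "complex vec"
  assumes v: "v \<in> carrier_vec n" "v \<noteq> 0\<^sub>v n"
  obtains W c where "W \<in> carrier_mat n n" "mat_adjoint W * W = 1\<^sub>m n" "col W 0 = c \<cdot>\<^sub>v v"
proof -
  interpret cof_vec_space n "TYPE(complex)" .
  define b where "b = basis_completion v"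
  define ws where "ws = gram_schmidt n b"
  have n: "n \<noteq> 0" using v by auto
  from basis_completion[OF v, folded b_def]
  have b: "distinct b" "\<not> lin_dep (set b)" "set b \<subseteq> carrier_vec n" "hd b = v" "length b = n"
    by auto
  from gram_schmidt_result[OF b(3,1,2) refl, folded ws_def] b
  have ws: "set ws \<subseteq> carrier_vec n" "corthogonal ws" "length ws = n" by auto
  have "b = v # tl b" using b n by (cases b) auto
  hence hdws: "hd ws = v" using gram_schmidt_hd[OF v(1), of "tl b"] by (simp add: ws_def)
  hence ws0: "ws ! 0 = v" using ws n by (metis hd_conv_nth length_0_conv)
  \<comment> \<open>Gram-Schmidt here orthogonalizes without normalizing, so the columns still have
    to be scaled to length 1.\<close>
  define r where "r i = complex_of_real (1 / sqrt (sq_norm2 (ws ! i)))" for i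
  define W where "W = mat n n (\<lambda>(i, j). r j * ws ! j $ i)"
  have wsc: "ws ! i \<in> carrier_vec n" if "i < n" for i using ws that by auto
  have "mat_adjoint W * W = 1\<^sub>m n"
  proof (rule eq_matI)
    fix i j assume ij: "i < dim_row (1\<^sub>m n :: complex mat)" "j < dim_col (1\<^sub>m n :: complex mat)"
    hence ij': "i < n" "j < n" by auto
    have "(mat_adjoint W * W) $$ (i, j) = (\<Sum>k<n. r i * r j * (ws ! j $ k * cnj (ws ! i $ k)))"
      using ij' by (auto simp: W_def scalar_prod_def atLeast0LessThan r_def intro!: sum.cong)
    also have "\<dots> = r i * r j * (ws ! j \<bullet>c ws ! i)"
      using wsc[OF ij'(1)] wsc[OF ij'(2)]
      by (simp add: scalar_prod_def atLeast0LessThan sum_distrib_left)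
    also have "\<dots> = (if i = j then 1 else 0)"
    proof (cases "i = j")
      case True
      \<comment> \<open>\<open>corthogonal\<close> also says that no vector of the list is
        orthogonal to itself, so no norm vanishes.\<close>
      have "ws ! i \<bullet>c ws ! i \<noteq> 0" using ws ij' corthogonalD by metis
      hence "sq_norm2 (ws ! i) > 0" using sq_norm2_nonneg[of "ws ! i"]
        by (simp add: cscalar_prod_self less_le)
      hence "1 / sqrt (sq_norm2 (ws ! i)) * (1 / sqrt (sq_norm2 (ws ! i))) * sq_norm2 (ws ! i) = 1"
        by (simp add: field_simps)
      hence "r i * r i * complex_of_real (sq_norm2 (ws ! i)) = 1"
        unfolding r_def of_real_mult[symmetric] by (simp only: of_real_1)
      thus ?thesis using True by (simp add: cscalar_prod_self)
    next
      case False
      thus ?thesis using ws ij' corthogonalD[of ws j i] by auto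
    qed
    finally show "(mat_adjoint W * W) $$ (i, j) = 1\<^sub>m n $$ (i, j)" using ij' by simp
  qed (simp_all add: W_def)
  moreover have "col W 0 = r 0 \<cdot>\<^sub>v v"
    using n v by (intro eq_vecI) (simp_all add: W_def ws0)
  moreover have "W \<in> carrier_mat n n" by (simp add: W_def)
  ultimately show ?thesis using that by blast
qed

lemma mat_adjoint_four_block_diag:
  fixes A D :: "complex mat"
  assumes "A \<in> carrier_mat k k" "D \<in> carrier_mat m m"
  shows "mat_adjoint (four_block_mat A (0\<^sub>m k m) (0\<^sub>m m k) D) =
           four_block_mat (mat_adjoint A) (0\<^sub>m k m) (0\<^sub>m m k) (mat_adjoint D)"
  using assms by (intro eq_matI) auto

text \<open>Deflation: conjugating with a unitary matrix whose first column is an eigenvector for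
  the head of \<open>es\<close> leaves a smaller Hermitian block whose characteristic polynomial
  belongs to the tail. The diagonal follows the given order of \<open>es\<close>, so the eigenvalues
  can be sorted beforehand.\<close>

theorem hermitian_unitarily_diagonalizable:
  fixes A :: "complex mat"
  assumes "A \<in> carrier_mat n n" "mat_adjoint A = A"
    and "char_poly A = (\<Prod>e\<leftarrow>es. [:- e, 1:])"
  shows "\<exists>P\<in>carrier_mat n n. mat_adjoint P * P = 1\<^sub>m n \<and>
           mat_adjoint P * A * P = mat n n (\<lambda>(i, j). if i = j then es ! i else 0)"
  using assms
proof (induct es arbitrary: n A)
  case Nil
  hence "n = 0" using degree_monic_char_poly[of A n] by auto
  thus ?case by (intro bexI[of _ "1\<^sub>m 0"]) auto
next
  case (Cons e es n A)
  note A = \<open>A \<in> carrier_mat n n\<close>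
  have cp: "char_poly A = [:- e, 1:] * (\<Prod>e\<leftarrow>es. [:- e, 1:])" using Cons by auto
  have mon: "monic (\<Prod>e\<leftarrow>es. [:- e, 1:])" by (rule monic_prod_list) auto
  have "degree (char_poly A) = Suc (degree (\<Prod>e\<leftarrow>es. [:- e, 1:]))" unfolding cp
    by (subst degree_mult_eq, insert mon, auto)
  then obtain m where n: "n = Suc m" using degree_monic_char_poly[OF A] by (cases n) auto
  have "eigenvalue A e" unfolding eigenvalue_root_char_poly[OF A] cp by simp
  then obtain v where v: "v \<in> carrier_vec n" "v \<noteq> 0\<^sub>v n" and ev: "A *\<^sub>v v = e \<cdot>\<^sub>v v"
    using A by (auto simp: eigenvalue_def eigenvector_def)
  obtain W c where W: "W \<in> carrier_mat n n" "mat_adjoint W * W = 1\<^sub>m n" "col W 0 = c \<cdot>\<^sub>v v"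
    by (rule exists_unitary_first_col[OF v])
  have Wa: "mat_adjoint W \<in> carrier_mat n n" using W by simp
  have WW: "W * mat_adjoint W = 1\<^sub>m n" using mat_mult_left_right_inverse[OF Wa W(1,2)] .
  define A' where "A' = mat_adjoint W * A * W"
  have A': "A' \<in> carrier_mat n n" using W A by (auto simp: A'_def)
  have "similar_mat_wit A' A (mat_adjoint W) W"
    by (rule similar_mat_witI[of _ _ n]) (use W A A' WW in \<open>auto simp: A'_def\<close>)
  hence sim: "char_poly A' = char_poly A"
    by (intro char_poly_similar) (auto simp: similar_mat_def)
  have herm': "mat_adjoint A' = A'"
  proof -
    have "mat_adjoint A' = mat_adjoint W * mat_adjoint (mat_adjoint W * A)"
      unfolding A'_def by (rule mat_adjoint_mult[of _ n n]) (use W A in auto)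
    also have "mat_adjoint (mat_adjoint W * A) = mat_adjoint A * W"
      by (subst mat_adjoint_mult[of _ n n _ n]) (use W A in auto)
    finally show ?thesis using W A Cons(3) Wa by (simp add: A'_def assoc_mult_mat[of _ n n _ n _ n])
  qed
  have n0: "0 < n" by (simp add: n)
  have "col A' 0 = mat_adjoint W *\<^sub>v (A *\<^sub>v col W 0)"
    unfolding A'_def assoc_mult_mat[OF Wa A W(1)] col_mult2[OF Wa mult_carrier_mat[OF A W(1)] n0]
      col_mult2[OF A W(1) n0] ..
  also have "A *\<^sub>v col W 0 = e \<cdot>\<^sub>v col W 0"
    using A v ev by (simp add: W mult_mat_vec smult_smult_assoc mult.commute)
  also have "mat_adjoint W *\<^sub>v (e \<cdot>\<^sub>v col W 0) = e \<cdot>\<^sub>v (mat_adjoint W *\<^sub>v col W 0)"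
    by (rule mult_mat_vec[OF Wa]) (use W v in auto)
  also have "mat_adjoint W *\<^sub>v col W 0 = col (mat_adjoint W * W) 0"
    by (rule col_mult2[OF Wa W(1), symmetric]) (simp add: n)
  also have "col (mat_adjoint W * W) 0 = unit_vec n 0" using W n by simp
  finally have col0: "col A' 0 = e \<cdot>\<^sub>v unit_vec n 0" .
  have A'0: "A' $$ (i, 0) = (if i = 0 then e else 0)" if "i < n" for i
    using arg_cong[OF col0, of "\<lambda>v. v $ i"] that A' n by auto
  \<comment> \<open>Hermitian symmetry carries the zeros of the first column over to the first row,
    which makes \<open>A'\<close> block diagonal.\<close>
  have A'0': "A' $$ (0, i) = (if i = 0 then e else 0)" if "i < n" for i
  proof (cases "i = 0")
    case False
    have "A' $$ (0, i) = conjugate (A' $$ (i, 0))"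
      using arg_cong[OF herm', of "\<lambda>B. B $$ (0, i)"] A' that n by simp
    thus ?thesis using A'0[OF that] False by simp
  qed (use A'0[of 0] n in auto)
  define A3 where "A3 = mat m m (\<lambda>(i, j). A' $$ (Suc i, Suc j))"
  have A3: "A3 \<in> carrier_mat m m" by (simp add: A3_def)
  let ?E = "mat 1 1 (\<lambda>_. e)"
  have blk: "A' = four_block_mat ?E (0\<^sub>m 1 m) (0\<^sub>m m 1) A3"
    using A' n A'0 A'0' by (intro eq_matI) (auto simp: A3_def)
  have "char_poly A' = char_poly ?E * char_poly A3"
    unfolding blk by (rule char_poly_four_block_zeros_col[OF _ _ A3]) auto
  also have "char_poly ?E = [:- e, 1:]"
    by (simp add: char_poly_defs det_def sign_def)
  finally have cp3: "char_poly A3 = (\<Prod>e\<leftarrow>es. [:- e, 1:])"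
    unfolding sim cp by (metis mult_cancel_left pCons_eq_0_iff zero_neq_one)
  have herm3: "mat_adjoint A3 = A3"
  proof (rule eq_matI)
    fix i j assume "i < dim_row A3" "j < dim_col A3"
    hence ij: "i < m" "j < m" by (auto simp: A3_def)
    show "mat_adjoint A3 $$ (i, j) = A3 $$ (i, j)"
      using arg_cong[OF herm', of "\<lambda>B. B $$ (Suc i, Suc j)"] A' ij n by (simp add: A3_def)
  qed (simp_all add: A3_def)
  from Cons(1)[OF A3 herm3 cp3] obtain P where P: "P \<in> carrier_mat m m"
    and PP: "mat_adjoint P * P = 1\<^sub>m m"
    and PAP: "mat_adjoint P * A3 * P = mat m m (\<lambda>(i, j). if i = j then es ! i else 0)"
    by blast
  let ?F = "four_block_mat (1\<^sub>m 1) (0\<^sub>m 1 m) (0\<^sub>m m 1) P"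
  have adj1: "mat_adjoint (1\<^sub>m 1 :: complex mat) = 1\<^sub>m 1" by (intro eq_matI) auto
  have Fa: "mat_adjoint ?F = four_block_mat (1\<^sub>m 1) (0\<^sub>m 1 m) (0\<^sub>m m 1) (mat_adjoint P)"
    by (subst mat_adjoint_four_block_diag[OF _ P]) (simp_all only: adj1 one_carrier_mat)
  have F: "?F \<in> carrier_mat n n" using P n by (metis four_block_carrier_mat one_carrier_mat plus_1_eq_Suc)
  have FF: "mat_adjoint ?F * ?F = 1\<^sub>m n"
    unfolding Fa using P n PP
    by (subst mult_four_block_mat[of _ 1 1 _ m _ m]) (auto intro!: eq_matI)
  have FAF: "mat_adjoint ?F * A' * ?F = mat n n (\<lambda>(i, j). if i = j then (e # es) ! i else 0)"
  proof -
    have "mat_adjoint ?F * A' = four_block_mat ?E (0\<^sub>m 1 m) (0\<^sub>m m 1) (mat_adjoint P * A3)"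
      unfolding Fa blk using P A3
      by (subst mult_four_block_mat[of _ 1 1 _ m _ m]) auto
    also have "\<dots> * ?F = four_block_mat ?E (0\<^sub>m 1 m) (0\<^sub>m m 1) (mat_adjoint P * A3 * P)"
      using P A3 by (subst mult_four_block_mat[of _ 1 1 _ m _ m]) auto
    finally show ?thesis unfolding PAP using n by (auto intro!: eq_matI simp: nth_Cons')
  qed
  let ?P = "W * ?F"
  have P': "?P \<in> carrier_mat n n" using W F by auto
  have Pa: "mat_adjoint ?P = mat_adjoint ?F * mat_adjoint W"
    using mat_adjoint_mult[OF W(1) F] .
  have Fac: "mat_adjoint ?F \<in> carrier_mat n n" using F by simp
  have "mat_adjoint ?P * ?P = mat_adjoint ?F * (mat_adjoint W * W * ?F)"
    unfolding Pa assoc_mult_mat[OF Fac Wa P'] assoc_mult_mat[OF Wa W(1) F] ..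
  hence 1: "mat_adjoint ?P * ?P = 1\<^sub>m n" unfolding W(2) left_mult_one_mat[OF F] FF .
  have "mat_adjoint ?P * A * ?P = mat_adjoint ?F * A' * ?F"
  proof -
    have "mat_adjoint ?P * A * ?P = mat_adjoint ?F * (mat_adjoint W * A) * (W * ?F)"
      unfolding Pa using assoc_mult_mat[OF Fac Wa A] by simp
    also have "\<dots> = mat_adjoint ?F * ((mat_adjoint W * A) * (W * ?F))"
      by (rule assoc_mult_mat[of _ n n _ n _ n]) (use Fac Wa A P' in auto)
    also have "(mat_adjoint W * A) * (W * ?F) = A' * ?F"
      unfolding A'_def by (rule assoc_mult_mat[symmetric, of _ n n _ n _ n]) (use Wa A W F in auto)
    also have "mat_adjoint ?F * (A' * ?F) = mat_adjoint ?F * A' * ?F"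
      by (rule assoc_mult_mat[OF Fac A' F, symmetric])
    finally show ?thesis .
  qed
  with FAF 1 P' show ?case by auto
qed

subsection \<open>Comparison of singular values\<close>

text \<open>Every entry of \<open>x\<close> is at most the norm of \<open>x\<close>, so every entry
  of the product is at most \<open>n * B\<close> times that norm. The constant is crude, but it
  depends only on \<open>n\<close> and \<open>B\<close>.\<close>

lemma sq_norm2_mult_le:
  assumes A: "A \<in> carrier_mat n n" and x: "x \<in> carrier_vec n"
    and B: "\<And>i j. i < n \<Longrightarrow> j < n \<Longrightarrow> cmod (A $$ (i, j)) \<le> B"
  shows "sq_norm2 (A *\<^sub>v x) \<le> n * (n * B)\<^sup>2 * sq_norm2 x"
proof -
  define r where "r = sqrt (sq_norm2 x)"
  have xr: "cmod (x $ j) \<le> r" if "j < n" for j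
  proof -
    have "(cmod (x $ j))\<^sup>2 \<le> sq_norm2 x"
      unfolding sq_norm2_def using that x by (intro member_le_sum) auto
    thus ?thesis unfolding r_def by (rule real_le_rsqrt)
  qed
  have "(cmod ((A *\<^sub>v x) $ i))\<^sup>2 \<le> (n * B)\<^sup>2 * sq_norm2 x" if i: "i < n" for i
  proof -
    have "cmod ((A *\<^sub>v x) $ i) = cmod (\<Sum>j<n. A $$ (i, j) * x $ j)"
      using A x i by (simp add: scalar_prod_def atLeast0LessThan)
    also have "\<dots> \<le> (\<Sum>j<n. B * r)"
    proof (rule order_trans[OF norm_sum], rule sum_mono)
      fix j assume "j \<in> {..<n}"
      hence j: "j < n" by simp
      show "cmod (A $$ (i, j) * x $ j) \<le> B * r"
        unfolding norm_mult using B[OF i j] xr[OF j]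
        by (intro mult_mono) (auto intro: order_trans[OF norm_ge_zero])
    qed
    finally have "(cmod ((A *\<^sub>v x) $ i))\<^sup>2 \<le> (n * B * r)\<^sup>2"
      by (intro power_mono) (auto simp: mult.assoc)
    thus ?thesis by (simp add: power_mult_distrib r_def)
  qed
  hence "(\<Sum>i<n. (cmod ((A *\<^sub>v x) $ i))\<^sup>2) \<le> (\<Sum>i<n. (n * B)\<^sup>2 * sq_norm2 x)"
    by (intro sum_mono) simp
  hence "sq_norm2 (A *\<^sub>v x) \<le> (\<Sum>i<n. (n * B)\<^sup>2 * sq_norm2 x)"
    using A by (simp add: sq_norm2_def[of "A *\<^sub>v x"])
  thus ?thesis by (simp add: mult_ac)
qed

text \<open>The Leibniz formula has \<open>fact n\<close> terms, each a product of \<open>n\<close>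
  entries.\<close>

lemma norm_det_le:
  fixes A :: "complex mat"
  assumes A: "A \<in> carrier_mat n n"
    and B: "\<And>i j. i < n \<Longrightarrow> j < n \<Longrightarrow> cmod (A $$ (i, j)) \<le> B"
  shows "cmod (det A) \<le> fact n * B ^ n"
proof -
  have "cmod (det A) \<le> (\<Sum>p\<in>{p. p permutes {0..<n}}. B ^ n)"
    unfolding det_def'[OF A]
  proof (rule order_trans[OF norm_sum], rule sum_mono)
    fix p assume p: "p \<in> {p. p permutes {0..<n}}"
    have "cmod (signof p * (\<Prod>i = 0..<n. A $$ (i, p i))) = (\<Prod>i = 0..<n. cmod (A $$ (i, p i)))"
      by (simp add: norm_mult prod_norm sign_def)
    also have "\<dots> \<le> (\<Prod>i = 0..<n. B)"
      using p by (intro prod_mono) (auto intro!: B simp: permutes_in_image)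
    finally show "cmod (signof p * (\<Prod>i = 0..<n. A $$ (i, p i))) \<le> B ^ n" by simp
  qed
  thus ?thesis by (simp add: card_permutations)
qed

text \<open>Cramer's rule: applying \<open>adj_mat A\<close> to \<open>A *\<^sub>v x\<close> gives
  \<open>det A\<close> times \<open>x\<close>, and the entries of the adjugate are, up to sign,
  minors of size \<open>n - 1\<close>, bounded by \<open>norm_det_le\<close>.\<close>

lemma sq_norm2_le_mult:
  assumes A: "A \<in> carrier_mat n n" and x: "x \<in> carrier_vec n"
    and B: "\<And>i j. i < n \<Longrightarrow> j < n \<Longrightarrow> cmod (A $$ (i, j)) \<le> B"
    and d: "d > 0" "d \<le> cmod (det A)"
  shows "sq_norm2 x \<le> n * (n * (fact (n - 1) * B ^ (n - 1)))\<^sup>2 / d\<^sup>2 * sq_norm2 (A *\<^sub>v x)"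
proof -
  let ?C = "fact (n - 1) * B ^ (n - 1)"
  have ad: "adj_mat A \<in> carrier_mat n n" by (rule adj_mat(1)[OF A])
  have C: "cmod (adj_mat A $$ (i, j)) \<le> ?C" if "i < n" "j < n" for i j
  proof -
    have "cmod (det (mat_delete A j i)) \<le> ?C"
    proof (rule norm_det_le)
      show "mat_delete A j i \<in> carrier_mat (n - 1) (n - 1)"
        using A that by (auto simp: mat_delete_def)
    qed (use A that in \<open>auto simp: mat_delete_def intro!: B\<close>)
    thus ?thesis using A that by (simp add: adj_mat_def cofactor_def norm_mult norm_power)
  qed
  have "adj_mat A *\<^sub>v (A *\<^sub>v x) = det A \<cdot>\<^sub>v x"
  proof -
    have "adj_mat A *\<^sub>v (A *\<^sub>v x) = (det A \<cdot>\<^sub>m 1\<^sub>m n) *\<^sub>v x"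
      using assoc_mult_mat_vec[OF ad A x] adj_mat(3)[OF A] by simp
    also have "\<dots> = det A \<cdot>\<^sub>v x" using x by (intro eq_vecI) auto
    finally show ?thesis .
  qed
  hence "sq_norm2 (adj_mat A *\<^sub>v (A *\<^sub>v x)) = (cmod (det A))\<^sup>2 * sq_norm2 x"
    using x by (simp add: sq_norm2_def norm_mult power_mult_distrib sum_distrib_left)
  hence "(cmod (det A))\<^sup>2 * sq_norm2 x \<le> n * (n * ?C)\<^sup>2 * sq_norm2 (A *\<^sub>v x)"
    using sq_norm2_mult_le[OF ad, of "A *\<^sub>v x" ?C] A x C by auto
  moreover have "d\<^sup>2 * sq_norm2 x \<le> (cmod (det A))\<^sup>2 * sq_norm2 x"
    using d by (intro mult_right_mono power_mono) auto
  ultimately show ?thesis using d by (simp add: field_simps)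
qed

text \<open>These are \<open>n - 1\<close> homogeneous equations in \<open>n\<close> unknowns. A
  zero row in place \<open>k\<close> keeps the system square, so that a vanishing determinant yields
  the solution.\<close>

lemma exists_vec_orthogonal_rows:
  fixes r :: "nat \<Rightarrow> 'a :: idom vec"
  assumes k: "k < n" and r: "\<And>i. i < n \<Longrightarrow> r i \<in> carrier_vec n"
  obtains y where "y \<in> carrier_vec n" "y \<noteq> 0\<^sub>v n" "\<And>i. i < n \<Longrightarrow> i \<noteq> k \<Longrightarrow> r i \<bullet> y = 0"
proof -
  let ?M = "mat\<^sub>r n n (\<lambda>i. if i = k then 0\<^sub>v n else r i)"
  have "det ?M = 0" by (rule det_row_0[OF k]) (use r in auto)
  then obtain y where y: "y \<in> carrier_vec n" "y \<noteq> 0\<^sub>v n" "?M *\<^sub>v y = 0\<^sub>v n"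
    using det_0_iff_vec_prod_zero[of ?M n] by auto
  have "r i \<bullet> y = 0" if "i < n" "i \<noteq> k" for i
  proof -
    have "(?M *\<^sub>v y) $ i = row ?M i \<bullet> y" using that by simp
    also have "row ?M i = r i" using that r[of i] by (intro eq_vecI) auto
    finally show ?thesis using y that by simp
  qed
  thus ?thesis using that y by blast
qed

text \<open>A min-max comparison of two quadratic forms: \<open>a\<close> relates the squared length
  of \<open>V *\<^sub>v x\<close> to the form with weights \<open>(d i)\<^sup>2\<close> in the
  coordinates \<open>U *\<^sub>v x\<close>, and \<open>b\<close> measures how far \<open>U\<close>
  is from an isometry. Their \<open>k\<close>-th largest values differ by at most the factor
  \<open>a * b\<close>, hence the square root for singular values.\<close>

theorem singular_values_compare:
  fixes V U :: "complex mat" and d :: "nat \<Rightarrow> real"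
  assumes V: "V \<in> carrier_mat n n" and U: "U \<in> carrier_mat n n" and ab: "a \<ge> 0" "b \<ge> 0"
    and V_le: "\<And>x. x \<in> carrier_vec n \<Longrightarrow>
      sq_norm2 (V *\<^sub>v x) \<le> a * (\<Sum>i<n. (d i)\<^sup>2 * (cmod ((U *\<^sub>v x) $ i))\<^sup>2)"
    and V_ge: "\<And>x. x \<in> carrier_vec n \<Longrightarrow>
      (\<Sum>i<n. (d i)\<^sup>2 * (cmod ((U *\<^sub>v x) $ i))\<^sup>2) \<le> a * sq_norm2 (V *\<^sub>v x)"
    and U_le: "\<And>x. x \<in> carrier_vec n \<Longrightarrow> sq_norm2 (U *\<^sub>v x) \<le> b * sq_norm2 x"
    and U_ge: "\<And>x. x \<in> carrier_vec n \<Longrightarrow> sq_norm2 x \<le> b * sq_norm2 (U *\<^sub>v x)"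
    and d: "\<And>i. i < n \<Longrightarrow> d i \<ge> 0"
    and p: "bij_betw p {..<n} {..<n}"
    and d_anti: "\<And>i j. i \<le> j \<Longrightarrow> j < n \<Longrightarrow> d (p j) \<le> d (p i)"
  obtains svs where "length svs = n" "mset svs = singular_values V"
    "\<And>k. k < n \<Longrightarrow> svs ! k \<ge> 0"
    "\<And>k. k < n \<Longrightarrow> svs ! k \<le> sqrt (a * b) * d (p k)"
    "\<And>k. k < n \<Longrightarrow> d (p k) \<le> sqrt (a * b) * svs ! k"
proof -
  let ?A = "mat_adjoint V * V"
  have Va: "mat_adjoint V \<in> carrier_mat n n" using V by simp
  have A: "?A \<in> carrier_mat n n" using V Va by auto
  have herm: "mat_adjoint ?A = ?A" using mat_adjoint_mult[OF Va V] by simp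
  obtain rs where rs: "mset rs = proots (char_poly ?A)" using ex_mset by blast
  \<comment> \<open>Largest first, to match the decreasing list of the \<open>d (p k)\<close>. The
    key is the real part, since the eigenvalues are not yet known to be real.\<close>
  define es where "es = sort_key (\<lambda>z. - Re z) rs"
  have es: "mset es = proots (char_poly ?A)" by (simp add: es_def rs)
  have "monic (char_poly ?A)" using degree_monic_char_poly[OF A] by simp
  hence "char_poly ?A = (\<Prod>x\<in>#proots (char_poly ?A). [:- x, 1:])"
    using complex_poly_decompose_multiset[of "char_poly ?A"] by simp
  also have "\<dots> = (\<Prod>e\<leftarrow>es. [:- e, 1:])" unfolding es[symmetric]
    by (subst prod_mset_prod_list[symmetric]) simp
  finally have cp: "char_poly ?A = (\<Prod>e\<leftarrow>es. [:- e, 1:])" .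
  have len: "length es = n"
    using size_proots_complex[of "char_poly ?A"] degree_monic_char_poly[OF A] es
    by (metis size_mset)
  from hermitian_unitarily_diagonalizable[OF A herm cp] obtain P
    where P: "P \<in> carrier_mat n n" and PP: "mat_adjoint P * P = 1\<^sub>m n"
      and PAP: "mat_adjoint P * ?A * P = mat n n (\<lambda>(i, j). if i = j then es ! i else 0)"
    by blast
  have Pa: "mat_adjoint P \<in> carrier_mat n n" using P by simp
  have P_iso: "sq_norm2 (P *\<^sub>v y) = sq_norm2 y" if y: "y \<in> carrier_vec n" for y
  proof -
    have "complex_of_real (sq_norm2 (P *\<^sub>v y)) = of_real (sq_norm2 y)"
      unfolding sq_norm2_mult_mat_vec[OF P y] PP using y by (simp add: cscalar_prod_self)
    thus ?thesis by simp
  qed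
  have VP: "V * P \<in> carrier_mat n n" using V P by simp
  have VPVP: "mat_adjoint (V * P) * (V * P) = mat n n (\<lambda>(i, j). if i = j then es ! i else 0)"
  proof -
    have "mat_adjoint (V * P) * (V * P) = mat_adjoint P * (mat_adjoint V * (V * P))"
      unfolding mat_adjoint_mult[OF V P] by (rule assoc_mult_mat[OF Pa Va VP])
    also have "mat_adjoint V * (V * P) = ?A * P" using assoc_mult_mat[OF Va V P] by simp
    also have "mat_adjoint P * (?A * P) = mat_adjoint P * ?A * P"
      using assoc_mult_mat[OF Pa A P] by simp
    finally show ?thesis using PAP by simp
  qed
  have VPy: "complex_of_real (sq_norm2 (V *\<^sub>v (P *\<^sub>v y))) = (\<Sum>i<n. es ! i * of_real ((cmod (y $ i))\<^sup>2))"
    if y: "y \<in> carrier_vec n" for y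
  proof -
    have "complex_of_real (sq_norm2 (V *\<^sub>v (P *\<^sub>v y))) = of_real (sq_norm2 ((V * P) *\<^sub>v y))"
      using assoc_mult_mat_vec[OF V P y] by simp
    also have "\<dots> = (mat n n (\<lambda>(i, j). if i = j then es ! i else 0) *\<^sub>v y) \<bullet>c y"
      unfolding sq_norm2_mult_mat_vec[OF VP y] VPVP ..
    also have "\<dots> = (\<Sum>i<n. (\<Sum>j<n. (if i = j then es ! i else 0) * y $ j) * cnj (y $ i))"
      using y by (simp add: scalar_prod_def atLeast0LessThan)
    also have "\<dots> = (\<Sum>i<n. es ! i * of_real ((cmod (y $ i))\<^sup>2))"
    proof (rule sum.cong[OF refl])
      fix i assume "i \<in> {..<n}"
      hence "(\<Sum>j<n. (if i = j then es ! i else 0) * y $ j) = es ! i * y $ i"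
        by (simp add: if_distrib[of "\<lambda>t. t * _"] cong: if_cong)
      thus "(\<Sum>j<n. (if i = j then es ! i else 0) * y $ j) * cnj (y $ i) =
          es ! i * of_real ((cmod (y $ i))\<^sup>2)"
        by (simp add: complex_norm_square mult.assoc del: of_real_power)
    qed
    finally show ?thesis .
  qed
  \<comment> \<open>At a unit vector the diagonalized form returns a single eigenvalue, which is
    therefore a squared length.\<close>
  have es_real: "es ! i = of_real (Re (es ! i))" "Re (es ! i) \<ge> 0" if i: "i < n" for i
  proof -
    have "(\<Sum>j<n. es ! j * of_real ((cmod (unit_vec n i $ j))\<^sup>2)) = (\<Sum>j<n. if j = i then es ! j else 0)"
      using i by (intro sum.cong) auto
    hence "es ! i = of_real (sq_norm2 (V *\<^sub>v (P *\<^sub>v unit_vec n i)))"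
      using VPy[of "unit_vec n i"] i by simp
    thus "es ! i = of_real (Re (es ! i))" "Re (es ! i) \<ge> 0" by simp_all
  qed
  define s where "s i = Re (es ! i)" for i
  have VPy: "sq_norm2 (V *\<^sub>v (P *\<^sub>v y)) = (\<Sum>i<n. s i * (cmod (y $ i))\<^sup>2)"
    if y: "y \<in> carrier_vec n" for y
    using arg_cong[OF VPy[OF y], of Re] by (simp add: s_def del: of_real_power)
  have s_anti: "s j \<le> s i" if "i \<le> j" "j < n" for i j
    using that sorted_nth_mono[of "map (\<lambda>z. - Re z) es" i j] len
    by (simp add: s_def es_def)
  have s_nonneg: "s i \<ge> 0" if "i < n" for i using es_real(2)[OF that] by (simp add: s_def)
  have p_lt: "p i < n" if "i < n" for i using bij_betwE[OF p] that by auto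
  have UP: "U * P \<in> carrier_mat n n" using U P by simp
  have UPy: "(U *\<^sub>v (P *\<^sub>v y)) $ i = row (U * P) i \<bullet> y" if "y \<in> carrier_vec n" "i < n" for y i
    using that U P assoc_mult_mat_vec[OF U P that(1)] by (metis UP carrier_matD(1) index_mult_mat_vec)
  have reidx: "(\<Sum>i<n. f i) = (\<Sum>i<n. f (p i))" for f :: "nat \<Rightarrow> real"
    by (rule sum.reindex_bij_betw[OF p, symmetric])
  have Uc: "U *\<^sub>v (P *\<^sub>v y) \<in> carrier_vec n" if "y \<in> carrier_vec n" for y using U P that by simp
  have Pc: "P *\<^sub>v y \<in> carrier_vec n" if "y \<in> carrier_vec n" for y using P that by simp
  have sqU: "sq_norm2 (U *\<^sub>v (P *\<^sub>v y)) = (\<Sum>i<n. (cmod ((U *\<^sub>v (P *\<^sub>v y)) $ p i))\<^sup>2)"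
    if "y \<in> carrier_vec n" for y
    unfolding sq_norm2_carrier[OF Uc[OF that]] by (rule reidx)
  \<comment> \<open>In both estimates \<open>y\<close> is a nonzero vector in the intersection of a span of eigenvectors with
    the preimage of a coordinate subspace; their dimensions add up to \<open>n + 1\<close>.\<close>
  have upper: "s k \<le> a * b * (d (p k))\<^sup>2" if k: "k < n" for k
  proof -
    obtain y where y: "y \<in> carrier_vec n" "y \<noteq> 0\<^sub>v n"
      and y0: "\<And>i. i < n \<Longrightarrow> i \<noteq> k \<Longrightarrow> (if i < k then row (U * P) (p i) else unit_vec n i) \<bullet> y = 0"
      by (rule exists_vec_orthogonal_rows[OF k,
            of "\<lambda>i. if i < k then row (U * P) (p i) else unit_vec n i"])
         (use UP k p_lt in \<open>auto intro!: row_carrier_vec[of _ n]\<close>)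
    have y1: "y $ i = 0" if "k < i" "i < n" for i using y0[of i] that y by auto
    have y2: "(U *\<^sub>v (P *\<^sub>v y)) $ p i = 0" if "i < k" for i
      using y0[of i] that k UPy[OF y(1) p_lt[of i]] by simp
    have "s k * sq_norm2 y = (\<Sum>i<n. s k * (cmod (y $ i))\<^sup>2)"
      using y by (simp add: sq_norm2_def sum_distrib_left)
    also have "\<dots> \<le> (\<Sum>i<n. s i * (cmod (y $ i))\<^sup>2)"
    proof (rule sum_mono)
      fix i assume "i \<in> {..<n}"
      thus "s k * (cmod (y $ i))\<^sup>2 \<le> s i * (cmod (y $ i))\<^sup>2"
        using y1[of i] s_anti[of i k] k by (cases "i \<le> k") (auto intro: mult_right_mono)
    qed
    also have "\<dots> \<le> a * (\<Sum>i<n. (d i)\<^sup>2 * (cmod ((U *\<^sub>v (P *\<^sub>v y)) $ i))\<^sup>2)"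
      using V_le[OF Pc[OF y(1)]] VPy[OF y(1)] by simp
    also have "(\<Sum>i<n. (d i)\<^sup>2 * (cmod ((U *\<^sub>v (P *\<^sub>v y)) $ i))\<^sup>2) =
        (\<Sum>i<n. (d (p i))\<^sup>2 * (cmod ((U *\<^sub>v (P *\<^sub>v y)) $ p i))\<^sup>2)" by (rule reidx)
    \<comment> \<open>The coordinates \<open>p i\<close> with \<open>i < k\<close> vanish by the
      choice of \<open>y\<close>; at the others \<open>d (p i)\<close> is at most
      \<open>d (p k)\<close>.\<close>
    also have "\<dots> \<le> (\<Sum>i<n. (d (p k))\<^sup>2 * (cmod ((U *\<^sub>v (P *\<^sub>v y)) $ p i))\<^sup>2)"
    proof (rule sum_mono)
      fix i assume "i \<in> {..<n}"
      thus "(d (p i))\<^sup>2 * (cmod ((U *\<^sub>v (P *\<^sub>v y)) $ p i))\<^sup>2 \<le>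
            (d (p k))\<^sup>2 * (cmod ((U *\<^sub>v (P *\<^sub>v y)) $ p i))\<^sup>2"
        using y2[of i] d_anti[of k i] d[OF p_lt[of i]] k
        by (cases "i < k") (auto intro!: mult_right_mono power_mono)
    qed
    also have "\<dots> = (d (p k))\<^sup>2 * sq_norm2 (U *\<^sub>v (P *\<^sub>v y))"
      by (simp add: sqU[OF y(1)] sum_distrib_left)
    also have "\<dots> \<le> (d (p k))\<^sup>2 * (b * sq_norm2 y)"
      using U_le[OF Pc[OF y(1)]] P_iso[OF y(1)] by (intro mult_left_mono) auto
    finally have "s k * sq_norm2 y \<le> a * ((d (p k))\<^sup>2 * (b * sq_norm2 y))"
      using ab by (blast intro: mult_left_mono)
    hence "s k * sq_norm2 y \<le> a * b * (d (p k))\<^sup>2 * sq_norm2 y"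
      by (simp add: mult_ac)
    thus ?thesis using sq_norm2_pos[OF y] by simp
  qed
  have lower: "(d (p k))\<^sup>2 \<le> a * b * s k" if k: "k < n" for k
  proof -
    obtain y where y: "y \<in> carrier_vec n" "y \<noteq> 0\<^sub>v n"
      and y0: "\<And>i. i < n \<Longrightarrow> i \<noteq> k \<Longrightarrow> (if i < k then unit_vec n i else row (U * P) (p i)) \<bullet> y = 0"
      by (rule exists_vec_orthogonal_rows[OF k,
            of "\<lambda>i. if i < k then unit_vec n i else row (U * P) (p i)"])
         (use UP k p_lt in \<open>auto intro!: row_carrier_vec[of _ n]\<close>)
    \<comment> \<open>The constraints are interchanged here: \<open>y\<close> lives on the indices
      from \<open>k\<close> on, where \<open>s\<close> is at most \<open>s k\<close>, and its image
      under \<open>U * P\<close> on the coordinates \<open>p i\<close> with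
      \<open>i \<le> k\<close>, where \<open>d\<close> is at least \<open>d (p k)\<close>.\<close>
    have y1: "y $ i = 0" if "i < k" for i using y0[of i] that y k by auto
    have y2: "(U *\<^sub>v (P *\<^sub>v y)) $ p i = 0" if "k < i" "i < n" for i
      using y0[of i] that UPy[OF y(1) p_lt[of i]] by simp
    have "sq_norm2 y \<le> b * sq_norm2 (U *\<^sub>v (P *\<^sub>v y))"
      using U_ge[OF Pc[OF y(1)]] P_iso[OF y(1)] by simp
    hence "(d (p k))\<^sup>2 * sq_norm2 y \<le> (d (p k))\<^sup>2 * (b * sq_norm2 (U *\<^sub>v (P *\<^sub>v y)))"
      by (intro mult_left_mono) auto
    also have "\<dots> = b * (\<Sum>i<n. (d (p k))\<^sup>2 * (cmod ((U *\<^sub>v (P *\<^sub>v y)) $ p i))\<^sup>2)"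
      by (simp add: sqU[OF y(1)] sum_distrib_left mult_ac)
    also have "\<dots> \<le> b * (\<Sum>i<n. (d (p i))\<^sup>2 * (cmod ((U *\<^sub>v (P *\<^sub>v y)) $ p i))\<^sup>2)"
    proof (rule mult_left_mono[OF sum_mono])
      fix i assume "i \<in> {..<n}"
      thus "(d (p k))\<^sup>2 * (cmod ((U *\<^sub>v (P *\<^sub>v y)) $ p i))\<^sup>2 \<le>
            (d (p i))\<^sup>2 * (cmod ((U *\<^sub>v (P *\<^sub>v y)) $ p i))\<^sup>2"
        using y2[of i] d_anti[of i k] d[OF p_lt[OF k]] k
        by (cases "k < i") (auto intro!: mult_right_mono power_mono)
    qed (use ab in auto)
    also have "\<dots> = b * (\<Sum>i<n. (d i)\<^sup>2 * (cmod ((U *\<^sub>v (P *\<^sub>v y)) $ i))\<^sup>2)"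
      by (subst reidx[symmetric]) simp
    also have "\<dots> \<le> b * (a * (\<Sum>i<n. s i * (cmod (y $ i))\<^sup>2))"
      using V_ge[OF Pc[OF y(1)]] VPy[OF y(1)] ab by (intro mult_left_mono) auto
    also have "(\<Sum>i<n. s i * (cmod (y $ i))\<^sup>2) \<le> (\<Sum>i<n. s k * (cmod (y $ i))\<^sup>2)"
    proof (rule sum_mono)
      fix i assume "i \<in> {..<n}"
      thus "s i * (cmod (y $ i))\<^sup>2 \<le> s k * (cmod (y $ i))\<^sup>2"
        using y1[of i] s_anti[of k i] by (cases "i < k") (auto intro: mult_right_mono)
    qed
    also have "(\<Sum>i<n. s k * (cmod (y $ i))\<^sup>2) = s k * sq_norm2 y"
      using y by (simp add: sq_norm2_def sum_distrib_left)
    finally have "(d (p k))\<^sup>2 * sq_norm2 y \<le> b * (a * (s k * sq_norm2 y))"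
      using ab by (blast intro: mult_left_mono)
    hence "(d (p k))\<^sup>2 * sq_norm2 y \<le> a * b * s k * sq_norm2 y"
      by (simp add: mult_ac)
    thus ?thesis using sq_norm2_pos[OF y] by simp
  qed
  show ?thesis
  proof (rule that[of "map (\<lambda>z. sqrt (Re z)) es"])
    fix k assume k: "k < n"
    have nth: "map (\<lambda>z. sqrt (Re z)) es ! k = sqrt (s k)" using k len by (simp add: s_def)
    show "map (\<lambda>z. sqrt (Re z)) es ! k \<ge> 0" using nth s_nonneg[OF k] by simp
    have dk: "d (p k) \<ge> 0" using d p_lt k by simp
    have "sqrt (s k) \<le> sqrt (a * b * (d (p k))\<^sup>2)" using upper[OF k] by simp
    thus "map (\<lambda>z. sqrt (Re z)) es ! k \<le> sqrt (a * b) * d (p k)"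
      unfolding nth using dk by (simp add: real_sqrt_mult)
    have "d (p k) \<le> sqrt (a * b * s k)" using lower[OF k] by (rule real_le_rsqrt)
    thus "d (p k) \<le> sqrt (a * b) * map (\<lambda>z. sqrt (Re z)) es ! k"
      unfolding nth by (simp add: real_sqrt_mult)
  qed (simp_all add: len singular_values_def es[symmetric])
qed

subsection \<open>Newton interpolation of the monomials\<close>

text \<open>The coefficient \<open>newton_coeff z k j\<close> is the divided difference of \<open>x ^ k\<close> at \<open>z 0, ..., z j\<close>;
  the recursion comes from \<open>x * N j = N (Suc j) + z j * N j\<close> for the Newton polynomials \<open>N\<close>.\<close>

fun newton_coeff :: "(nat \<Rightarrow> 'a :: comm_ring_1) \<Rightarrow> nat \<Rightarrow> nat \<Rightarrow> 'a" where
  "newton_coeff z 0 j = (if j = 0 then 1 else 0)"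
| "newton_coeff z (Suc k) 0 = z 0 * newton_coeff z k 0"
| "newton_coeff z (Suc k) (Suc j) = z (Suc j) * newton_coeff z k (Suc j) + newton_coeff z k j"

lemma newton_coeff_eq_0: "k < j \<Longrightarrow> newton_coeff z k j = 0"
  by (induct z k j rule: newton_coeff.induct) auto

lemma newton_coeff_self [simp]: "newton_coeff z k k = 1"
  by (induct k) (auto simp: newton_coeff_eq_0)

text \<open>Induction on \<open>k\<close>: multiplying the expansion by \<open>x\<close> reproduces
  the recursion of \<open>newton_coeff\<close>.\<close>

lemma power_eq_newton_sum:
  "x ^ k = (\<Sum>j\<le>k. newton_coeff z k j * (\<Prod>i<j. x - z i))"
proof (induct k)
  case (Suc k)
  let ?c = "newton_coeff z" and ?N = "\<lambda>j. \<Prod>i<j. x - z i"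
  have "x ^ Suc k = (\<Sum>j\<le>k. ?c k j * (x * ?N j))"
    by (simp add: Suc sum_distrib_left mult_ac)
  also have "\<dots> = (\<Sum>j\<le>k. ?c k j * ?N (Suc j)) + (\<Sum>j\<le>k. z j * ?c k j * ?N j)"
    by (simp add: sum.distrib[symmetric] algebra_simps)
  \<comment> \<open>The added term is zero, because the coefficient of index \<open>Suc k\<close> of
    a power \<open>k\<close> vanishes; it lets both sums run over the same shifted range.\<close>
  also have "(\<Sum>j\<le>k. z j * ?c k j * ?N j) = (\<Sum>j\<le>Suc k. z j * ?c k j * ?N j)"
    by (simp add: newton_coeff_eq_0)
  also have "\<dots> = z 0 * ?c k 0 + (\<Sum>j\<le>k. z (Suc j) * ?c k (Suc j) * ?N (Suc j))"
    by (subst sum.atMost_Suc_shift) simp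
  also have "(\<Sum>j\<le>k. ?c k j * ?N (Suc j)) + \<dots> =
      z 0 * ?c k 0 + (\<Sum>j\<le>k. ?c (Suc k) (Suc j) * ?N (Suc j))"
    by (simp only: newton_coeff.simps distrib_right sum.distrib) (simp only: ac_simps)
  also have "\<dots> = (\<Sum>j\<le>Suc k. ?c (Suc k) j * ?N j)"
    by (subst sum.atMost_Suc_shift) simp
  finally show ?case .
qed simp

text \<open>Each step of the recursion at most doubles the bound. Node distances do not enter, so
  divided differences stay bounded when nodes approach each other.\<close>

lemma norm_newton_coeff_le:
  fixes z :: "nat \<Rightarrow> complex"
  assumes "\<And>i. cmod (z i) \<le> 1"
  shows "cmod (newton_coeff z k j) \<le> 2 ^ k"
proof (induct k arbitrary: j)
  case (Suc k)
  have *: "cmod (z i * newton_coeff z k i) \<le> 2 ^ k" for i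
    unfolding norm_mult using mult_mono[OF assms[of i] Suc[of i]] by simp
  show ?case
  proof (cases j)
    case 0
    have "(2 :: real) ^ k \<le> 2 ^ Suc k" by (intro power_increasing) auto
    thus ?thesis using order_trans[OF *[of 0]] 0 by simp
  next
    case (Suc i)
    show ?thesis
      using norm_triangle_ineq[of "z (Suc i) * newton_coeff z k (Suc i)" "newton_coeff z k i"]
        *[of "Suc i"] Suc.hyps[of i] Suc by simp
  qed
qed simp

text \<open>The position of \<open>j\<close> in its class, counted from 0. It is both the degree of
  the Newton polynomial attached to \<open>j\<close> and the exponent of the scale at
  \<open>j\<close>.\<close>

definition rank_in_class :: "(nat \<Rightarrow> 'b) \<Rightarrow> nat \<Rightarrow> nat" where
  "rank_in_class cl j = card {i. i < j \<and> cl i = cl j}"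

lemma rank_in_class_mono:
  assumes "i < j" "cl i = cl j"
  shows "rank_in_class cl i < rank_in_class cl j"
  unfolding rank_in_class_def using assms by (intro psubset_card_mono) auto

lemma inj_on_rank_in_class: "inj_on (rank_in_class cl) {j. cl j = a}"
  by (rule inj_onI) (metis (mono_tags) less_irrefl linorder_neqE_nat mem_Collect_eq rank_in_class_mono)

text \<open>The ranks of the predecessors are distinct and lie below the rank of \<open>j\<close>,
  which by definition is the number of those predecessors, so they fill the whole initial
  segment.\<close>

lemma bij_betw_rank_in_class:
  "bij_betw (rank_in_class cl) {i. i < j \<and> cl i = cl j} {..<rank_in_class cl j}"
proof -
  have inj: "inj_on (rank_in_class cl) {i. i < j \<and> cl i = cl j}"
    by (rule inj_on_subset[OF inj_on_rank_in_class[of cl "cl j"]]) auto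
  have "rank_in_class cl ` {i. i < j \<and> cl i = cl j} = {..<rank_in_class cl j}"
  proof (rule card_subset_eq)
    show "rank_in_class cl ` {i. i < j \<and> cl i = cl j} \<subseteq> {..<rank_in_class cl j}"
      using rank_in_class_mono[of _ j cl] by auto
    show "card (rank_in_class cl ` {i. i < j \<and> cl i = cl j}) = card {..<rank_in_class cl j}"
      using card_image[OF inj] by (simp add: rank_in_class_def)
  qed simp
  with inj show ?thesis by (simp add: bij_betw_def)
qed

lemma bij_betw_rank_in_class_le:
  "bij_betw (rank_in_class cl) {i. i \<le> j \<and> cl i = cl j} {..rank_in_class cl j}"
proof -
  have "bij_betw (rank_in_class cl) ({i. i < j \<and> cl i = cl j} \<union> {j})
          ({..<rank_in_class cl j} \<union> {rank_in_class cl j})"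
    by (rule bij_betw_combine[OF bij_betw_rank_in_class]) (auto simp: bij_betw_def)
  moreover have "{i. i < j \<and> cl i = cl j} \<union> {j} = {i. i \<le> j \<and> cl i = cl j}" by auto
  moreover have "{..<rank_in_class cl j} \<union> {rank_in_class cl j} = {..rank_in_class cl j}" by auto
  ultimately show ?thesis by simp
qed

text \<open>The Newton polynomial of a class, indexed by the node \<open>j\<close> at which it is
  the next factor's turn instead of by its degree \<open>rank_in_class cl j\<close>.\<close>

definition class_prod :: "(nat \<Rightarrow> 'b) \<Rightarrow> (nat \<Rightarrow> complex) \<Rightarrow> nat \<Rightarrow> complex \<Rightarrow> complex" where
  "class_prod cl z j x = (\<Prod>i | i < j \<and> cl i = cl j. x - z i)"

lemma class_prod_eq_0: "i < j \<Longrightarrow> cl i = cl j \<Longrightarrow> class_prod cl z j (z i) = 0"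
  by (auto simp: class_prod_def)

text \<open>Newton interpolation is done in each class separately, with its nodes listed by rank;
  \<open>w k j\<close> is the divided difference of the \<open>k\<close>-th power over the class
  members up to \<open>j\<close>.\<close>

lemma power_eq_class_newton_sum:
  fixes z :: "nat \<Rightarrow> complex"
  assumes z: "\<And>i. cmod (z i) \<le> 1"
  obtains w where "\<And>k j. cmod (w k j) \<le> 2 ^ k"
    "\<And>k i. z i ^ k = (\<Sum>j | j \<le> i \<and> cl j = cl i. w k j * class_prod cl z j (z i))"
proof -
  let ?r = "rank_in_class cl"
  \<comment> \<open>The node of rank \<open>t\<close> in class \<open>a\<close>. For a rank that the
    class does not reach this is some value of \<open>z\<close>, which still lies in the unit disc,
    as the coefficient bound requires.\<close>
  define zs where "zs a t = z (inv_into {j. cl j = a} ?r t)" for a t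
  have zs: "zs (cl j) (?r j) = z j" for j
    unfolding zs_def by (subst inv_into_f_f[OF inj_on_rank_in_class]) auto
  have N: "class_prod cl z j x = (\<Prod>t<?r j. x - zs (cl j) t)" for j x
  proof -
    have "(\<Prod>t<?r j. x - zs (cl j) t) = (\<Prod>i | i < j \<and> cl i = cl j. x - zs (cl j) (?r i))"
      by (rule prod.reindex_bij_betw[OF bij_betw_rank_in_class, symmetric])
    also have "\<dots> = class_prod cl z j x"
      unfolding class_prod_def by (rule prod.cong) (metis (mono_tags) zs mem_Collect_eq | simp)+
    finally show ?thesis by simp
  qed
  define w where "w k j = newton_coeff (zs (cl j)) k (?r j)" for k j
  show ?thesis
  proof (rule that)
    show "cmod (w k j) \<le> 2 ^ k" for k j
      unfolding w_def by (rule norm_newton_coeff_le) (simp add: zs_def z)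
    fix k i
    define f where "f t = newton_coeff (zs (cl i)) k t * (\<Prod>u<t. z i - zs (cl i) u)" for t
    have f0: "f t = 0" if "t > ?r i" for t
      unfolding f_def using that zs[of i] by (auto intro!: exI[of _ "?r i"] bexI[of _ "?r i"])
    have "z i ^ k = (\<Sum>t\<le>k. f t)"
      unfolding f_def by (rule power_eq_newton_sum)
    \<comment> \<open>The cutoffs \<open>k\<close> and \<open>?r i\<close> are exchanged through a
      common upper bound: above \<open>k\<close> the coefficient vanishes, above \<open>?r i\<close>
      the product contains the factor \<open>z i - z i\<close>.\<close>
    also have "\<dots> = (\<Sum>t\<le>k + ?r i. f t)"
      by (rule sum.mono_neutral_left) (auto simp: f_def newton_coeff_eq_0)
    also have "\<dots> = (\<Sum>t\<le>?r i. f t)"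
      by (rule sum.mono_neutral_right) (auto simp: f0)
    also have "\<dots> = (\<Sum>j | j \<le> i \<and> cl j = cl i. f (?r j))"
      by (rule sum.reindex_bij_betw[OF bij_betw_rank_in_class_le, symmetric])
    also have "\<dots> = (\<Sum>j | j \<le> i \<and> cl j = cl i. w k j * class_prod cl z j (z i))"
      by (rule sum.cong) (auto simp: f_def w_def N)
    finally show "z i ^ k = (\<Sum>j | j \<le> i \<and> cl j = cl i. w k j * class_prod cl z j (z i))" .
  qed
qed

section \<open>Determinants of triangular matrices and of the Vandermonde matrix\<close>

lemma det_triangular_mat:
  fixes f :: "nat \<Rightarrow> nat \<Rightarrow> 'a :: idom"
  assumes "\<And>i j. i < n \<Longrightarrow> j < i \<Longrightarrow> f i j = 0"
  shows "det (mat n n (\<lambda>(i, j). f i j)) = (\<Prod>i<n. f i i)"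
proof -
  have "upper_triangular (mat n n (\<lambda>(i, j). f i j))" using assms by auto
  hence "det (mat n n (\<lambda>(i, j). f i j)) = prod_list (diag_mat (mat n n (\<lambda>(i, j). f i j)))"
    by (rule det_upper_triangular[of _ n]) simp
  also have "diag_mat (mat n n (\<lambda>(i, j). f i j)) = map (\<lambda>i. f i i) [0..<n]"
    by (auto simp: diag_mat_def)
  finally show ?thesis
    by (simp add: prod.list_conv_set_nth atLeast0LessThan)
qed

text \<open>The Newton expansion with all nodes in one class is a factorization into a lower
  triangular matrix with unit diagonal and an upper triangular one whose diagonal gives the
  product.\<close>

lemma det_power_mat:
  fixes z :: "nat \<Rightarrow> 'a :: idom"
  shows "det (mat n n (\<lambda>(k, i). z i ^ k)) = (\<Prod>j<n. \<Prod>i<j. z j - z i)"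
proof -
  let ?L = "mat n n (\<lambda>(k, j). newton_coeff z k j)"
  let ?R = "mat n n (\<lambda>(j, i). \<Prod>t<j. z i - z t)"
  have "mat n n (\<lambda>(k, i). z i ^ k) = ?L * ?R"
  proof (rule eq_matI)
    fix k i assume "k < dim_row (?L * ?R)" "i < dim_col (?L * ?R)"
    hence ki: "k < n" "i < n" by auto
    have "z i ^ k = (\<Sum>j\<le>k. newton_coeff z k j * (\<Prod>t<j. z i - z t))"
      by (rule power_eq_newton_sum)
    also have "\<dots> = (\<Sum>j<n. newton_coeff z k j * (\<Prod>t<j. z i - z t))"
      using ki by (intro sum.mono_neutral_left) (auto simp: newton_coeff_eq_0)
    finally show "mat n n (\<lambda>(k, i). z i ^ k) $$ (k, i) = (?L * ?R) $$ (k, i)"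
      using ki by (simp add: scalar_prod_def atLeast0LessThan)
  qed auto
  hence "det (mat n n (\<lambda>(k, i). z i ^ k)) = det ?L * det ?R"
    by (simp add: det_mult[of _ n])
  also have "det ?L = det (transpose_mat ?L)"
    by (simp add: det_transpose[of _ n])
  also have "transpose_mat ?L = mat n n (\<lambda>(j, k). newton_coeff z k j)"
    by (intro eq_matI) auto
  also have "det \<dots> = 1" by (subst det_triangular_mat) (auto simp: newton_coeff_eq_0)
  also have "det ?R = (\<Prod>j<n. \<Prod>t<j. z j - z t)"
    by (rule det_triangular_mat) auto
  finally show ?thesis by simp
qed

subsection \<open>Singular values of clustered Vandermonde matrices\<close>

lemma sort_key_permutation:
  fixes f :: "nat \<Rightarrow> 'a :: linorder"
  obtains p where "bij_betw p {..<n} {..<n}"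
    "\<And>i j. i \<le> j \<Longrightarrow> j < n \<Longrightarrow> f (p i) \<le> f (p j)"
proof (rule that[of "(!) (sort_key f [0..<n])"])
  show "bij_betw ((!) (sort_key f [0..<n])) {..<n} {..<n}"
    by (rule bij_betw_nth) auto
  fix i j assume "i \<le> j" "j < n"
  thus "f (sort_key f [0..<n] ! i) \<le> f (sort_key f [0..<n] ! j)"
    using sorted_nth_mono[of "map f (sort_key f [0..<n])" i j] by simp
qed

text \<open>Entries of the right factor with \<open>i < j\<close> vanish within a class, because
  \<open>z i\<close> is then a root of \<open>class_prod cl z j\<close>; across classes they are
  zero by definition. This factor is the product \<open>D U\<close> of the outline.\<close>

lemma power_mat_eq_mult_class_mats:
  fixes z :: "nat \<Rightarrow> complex"
  assumes "\<And>k i. z i ^ k = (\<Sum>j | j \<le> i \<and> cl j = cl i. w k j * class_prod cl z j (z i))"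
  shows "mat n n (\<lambda>(k, i). z i ^ k) = mat n n (\<lambda>(k, j). w k j) *
           mat n n (\<lambda>(j, i). if cl j = cl i then class_prod cl z j (z i) else 0)"
    (is "_ = ?W * ?R")
proof (rule eq_matI)
  fix k i assume "k < dim_row (?W * ?R)" "i < dim_col (?W * ?R)"
  hence ki: "k < n" "i < n" by auto
  have "(?W * ?R) $$ (k, i) = (\<Sum>j<n. w k j * (if cl j = cl i then class_prod cl z j (z i) else 0))"
    using ki by (simp add: scalar_prod_def atLeast0LessThan)
  also have "\<dots> = (\<Sum>j | j \<le> i \<and> cl j = cl i. w k j * class_prod cl z j (z i))"
    using ki by (intro sum.mono_neutral_cong_right)
      (auto, metis class_prod_eq_0 linorder_not_le)
  also have "\<dots> = z i ^ k" using assms by simp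
  finally show "mat n n (\<lambda>(k, i). z i ^ k) $$ (k, i) = (?W * ?R) $$ (k, i)"
    using ki by simp
qed auto

text \<open>In the Vandermonde product, pairs in one class form the \<open>class_prod\<close>
  factors. Each \<open>j\<close> has at most \<open>n\<close> partners in other classes, and as
  \<open>\<kappa> \<le> 1\<close> their factors multiply to at least
  \<open>\<kappa> ^ n\<close>.\<close>

lemma norm_det_power_mat_ge:
  fixes z :: "nat \<Rightarrow> complex"
  assumes kappa: "0 < \<kappa>" "\<kappa> \<le> 1"
    and sep: "\<And>i j. i < n \<Longrightarrow> j < n \<Longrightarrow> cl i \<noteq> cl j \<Longrightarrow> \<kappa> \<le> cmod (z i - z j)"
  shows "cmod (det (mat n n (\<lambda>(k, i). z i ^ k))) \<ge>
           (\<kappa> ^ n) ^ n * (\<Prod>j<n. cmod (class_prod cl z j (z j)))"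
proof -
  have "(\<Prod>j<n. \<kappa> ^ n * cmod (class_prod cl z j (z j))) \<le> (\<Prod>j<n. cmod (\<Prod>i<j. z j - z i))"
  proof (rule prod_mono, safe)
    fix j assume j: "j < n"
    let ?D = "{i. i < j \<and> cl i \<noteq> cl j}" and ?E = "{i. i < j \<and> cl i = cl j}"
    have "{..<j} = ?D \<union> ?E" by auto
    hence "(\<Prod>i<j. z j - z i) = (\<Prod>i\<in>?D. z j - z i) * class_prod cl z j (z j)"
      unfolding class_prod_def by (simp only:) (rule prod.union_disjoint; auto)
    moreover have "\<kappa> ^ n \<le> cmod (\<Prod>i\<in>?D. z j - z i)"
    proof -
      have "card ?D \<le> card {..<j}" by (rule card_mono) auto
      hence "\<kappa> ^ n \<le> \<kappa> ^ card ?D" using kappa j by (intro power_decreasing) auto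
      also have "\<dots> = (\<Prod>i\<in>?D. \<kappa>)" by simp
      also have "\<dots> \<le> (\<Prod>i\<in>?D. cmod (z j - z i))"
        using sep[of j] kappa j by (intro prod_mono) auto
      finally show ?thesis by (simp add: prod_norm)
    qed
    ultimately show "\<kappa> ^ n * cmod (class_prod cl z j (z j)) \<le> cmod (\<Prod>i<j. z j - z i)"
      by (simp add: norm_mult mult_right_mono)
    show "0 \<le> \<kappa> ^ n * cmod (class_prod cl z j (z j))" using kappa by simp
  qed
  thus ?thesis by (simp add: det_power_mat prod_norm prod.distrib)
qed

text \<open>The constant is fixed before the nodes, the labels and \<open>\<delta>\<close>, so it
  depends on \<open>n\<close>, \<open>\<kappa>\<close> and \<open>L\<close> only; this is the
  uniformity behind the asymptotic statement.\<close>

theorem singular_values_power_mat_clusters: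
  fixes n :: nat and \<kappa> L :: real
  assumes kappa: "0 < \<kappa>" "\<kappa> \<le> 1" and L: "L \<ge> 1"
  obtains C where "C > 0"
    "\<And>(z :: nat \<Rightarrow> complex) (cl :: nat \<Rightarrow> 'b) \<delta>.
       \<lbrakk>\<And>i. cmod (z i) \<le> 1; 0 < \<delta>; \<delta> \<le> 1;
        \<And>i j. i < n \<Longrightarrow> j < n \<Longrightarrow> i \<noteq> j \<Longrightarrow> cl i = cl j \<Longrightarrow> \<delta> \<le> cmod (z i - z j);
        \<And>i j. i < n \<Longrightarrow> j < n \<Longrightarrow> i \<noteq> j \<Longrightarrow> cl i = cl j \<Longrightarrow> cmod (z i - z j) \<le> L * \<delta>;
        \<And>i j. i < n \<Longrightarrow> j < n \<Longrightarrow> cl i \<noteq> cl j \<Longrightarrow> \<kappa> \<le> cmod (z i - z j)\<rbrakk> \<Longrightarrow>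
       \<exists>svs p. bij_betw p {..<n} {..<n} \<and> length svs = n \<and>
         mset svs = singular_values (mat n n (\<lambda>(k, i). z i ^ k)) \<and>
         (\<forall>k<n. svs ! k \<le> C * \<delta> ^ rank_in_class cl (p k) \<and>
                \<delta> ^ rank_in_class cl (p k) \<le> C * svs ! k)"
proof -
  \<comment> \<open>\<open>B\<close> and \<open>B'\<close> bound the entries of \<open>W\<close> and
    \<open>U\<close>, and \<open>dW\<close> and 1 bound their determinants from below. The four norm
    inequalities then hold with \<open>a1\<close>, \<open>a2\<close>, \<open>b1\<close>,
    \<open>b2\<close>; adding 1 to each maximum makes \<open>a\<close> and \<open>b\<close>
    positive.\<close>
  define B where "B = (2 :: real) ^ n"
  define B' where "B' = L ^ n"
  define dW where "dW = (\<kappa> ^ n) ^ n"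
  define a1 where "a1 = n * (n * B)\<^sup>2"
  define a2 where "a2 = n * (n * (fact (n - 1) * B ^ (n - 1)))\<^sup>2 / dW\<^sup>2"
  define b1 where "b1 = n * (n * B')\<^sup>2"
  define b2 where "b2 = n * (n * (fact (n - 1) * B' ^ (n - 1)))\<^sup>2 / 1\<^sup>2"
  define a where "a = max a1 a2 + 1"
  define b where "b = max b1 b2 + 1"
  have dW: "dW > 0" using kappa by (simp add: dW_def)
  have a1: "a1 \<ge> 0" by (simp add: a1_def)
  have b1: "b1 \<ge> 0" by (simp add: b1_def)
  have a: "a > 0" using a1 unfolding a_def by linarith
  have b: "b > 0" using b1 unfolding b_def by linarith
  have le: "a1 \<le> a" "a2 \<le> a" "b1 \<le> b" "b2 \<le> b" by (auto simp: a_def b_def)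
  show ?thesis
  proof (rule that[of "sqrt (a * b)"])
    show "sqrt (a * b) > 0" using a b by simp
    fix z :: "nat \<Rightarrow> complex" and cl :: "nat \<Rightarrow> 'b" and \<delta> :: real
    assume z: "\<And>i. cmod (z i) \<le> 1" and \<delta>: "0 < \<delta>" "\<delta> \<le> 1"
      and lo: "\<And>i j. i < n \<Longrightarrow> j < n \<Longrightarrow> i \<noteq> j \<Longrightarrow> cl i = cl j \<Longrightarrow> \<delta> \<le> cmod (z i - z j)"
      and up: "\<And>i j. i < n \<Longrightarrow> j < n \<Longrightarrow> i \<noteq> j \<Longrightarrow> cl i = cl j \<Longrightarrow> cmod (z i - z j) \<le> L * \<delta>"
      and sep: "\<And>i j. i < n \<Longrightarrow> j < n \<Longrightarrow> cl i \<noteq> cl j \<Longrightarrow> \<kappa> \<le> cmod (z i - z j)"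
    let ?r = "rank_in_class cl" and ?N = "class_prod cl z"
    obtain w where w: "\<And>k j. cmod (w k j) \<le> 2 ^ k"
      "\<And>k i. z i ^ k = (\<Sum>j | j \<le> i \<and> cl j = cl i. w k j * ?N j (z i))"
      using power_eq_class_newton_sum[where cl = cl and z = z, OF z, of thesis] by blast
    define V where "V = mat n n (\<lambda>(k, i). z i ^ k)"
    define W where "W = mat n n (\<lambda>(k, j). w k j)"
    define R where "R = mat n n (\<lambda>(j, i). if cl j = cl i then ?N j (z i) else 0)"
    \<comment> \<open>\<open>R\<close> with row \<open>j\<close> divided by its scale, so that
      \<open>R = D U\<close>.\<close>
    define U where "U = mat n n (\<lambda>(j, i). if cl j = cl i then ?N j (z i) / \<delta> ^ ?r j else 0)"
    have cm: "V \<in> carrier_mat n n" "W \<in> carrier_mat n n" "R \<in> carrier_mat n n" "U \<in> carrier_mat n n"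
      by (simp_all add: V_def W_def R_def U_def)
    have V: "V = W * R" unfolding V_def W_def R_def by (rule power_mat_eq_mult_class_mats) (rule w)
    have N_le: "cmod (?N j (z i)) \<le> (L * \<delta>) ^ ?r j" if "i < n" "j < n" "cl j = cl i" for i j
    proof -
      have "cmod (?N j (z i)) = (\<Prod>t | t < j \<and> cl t = cl j. cmod (z i - z t))"
        by (simp add: class_prod_def prod_norm)
      also have "\<dots> \<le> (\<Prod>t | t < j \<and> cl t = cl j. L * \<delta>)"
      proof (rule prod_mono, safe)
        fix t assume "t < j" "cl t = cl j"
        thus "cmod (z i - z t) \<le> L * \<delta>" using up[of i t] that L \<delta> by (cases "t = i") auto
      qed auto
      finally show ?thesis by (simp add: rank_in_class_def)
    qed
    have N_ge: "cmod (?N j (z j)) \<ge> \<delta> ^ ?r j" if "j < n" for j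
    proof -
      have "(\<Prod>t | t < j \<and> cl t = cl j. \<delta>) \<le> (\<Prod>t | t < j \<and> cl t = cl j. cmod (z j - z t))"
        using that \<delta> lo[of j] by (intro prod_mono) auto
      thus ?thesis by (simp add: class_prod_def prod_norm rank_in_class_def)
    qed
    have r_le: "?r j \<le> j" for j
      using card_mono[of "{..<j}" "{i. i < j \<and> cl i = cl j}"] by (auto simp: rank_in_class_def)
    have U_entry: "cmod (U $$ (j, i)) \<le> B'" if "j < n" "i < n" for i j
    proof (cases "cl j = cl i")
      case True
      have "cmod (U $$ (j, i)) = cmod (?N j (z i)) / \<delta> ^ ?r j"
        using that True \<delta> by (simp add: U_def norm_divide norm_power)
      also have "\<dots> \<le> (L * \<delta>) ^ ?r j / \<delta> ^ ?r j"
        using N_le[OF that(2,1) True] \<delta> by (simp add: divide_right_mono)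
      also have "\<dots> = L ^ ?r j" using \<delta> by (simp add: power_mult_distrib)
      also have "\<dots> \<le> L ^ n" using L r_le[of j] that by (intro power_increasing) auto
      finally show ?thesis by (simp add: B'_def)
    qed (use that L in \<open>simp add: U_def B'_def\<close>)
    have W_entry: "cmod (W $$ (k, j)) \<le> B" if "k < n" "j < n" for k j
    proof -
      have "(2 :: real) ^ k \<le> 2 ^ n" using that by (intro power_increasing) auto
      thus ?thesis using that order_trans[OF w(1)] by (simp add: W_def B_def)
    qed
    have det_R: "det R = (\<Prod>j<n. ?N j (z j))"
      unfolding R_def by (subst det_triangular_mat) (auto simp: class_prod_eq_0)
    have "det U = (\<Prod>j<n. ?N j (z j) / \<delta> ^ ?r j)"
      unfolding U_def by (subst det_triangular_mat) (auto simp: class_prod_eq_0)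
    moreover have "(\<Prod>j<n. 1) \<le> (\<Prod>j<n. cmod (?N j (z j) / \<delta> ^ ?r j))"
      using N_ge \<delta> by (intro prod_mono) (auto simp: norm_divide norm_power)
    ultimately have det_U: "1 \<le> cmod (det U)" by (simp add: prod_norm)
    have N_pos: "(\<Prod>j<n. cmod (?N j (z j))) > 0"
    proof (rule prod_pos, safe)
      fix j assume "j < n"
      thus "0 < cmod (?N j (z j))"
        using N_ge[of j] \<delta> zero_less_power[OF \<delta>(1), of "?r j"] by linarith
    qed
    \<comment> \<open>The product of the Newton values is also the modulus of \<open>det R\<close>.
      Cancelling it removes every power of \<open>\<delta>\<close> and leaves a bound for
      \<open>det W\<close> that is uniform in the nodes.\<close>
    have "dW * (\<Prod>j<n. cmod (?N j (z j))) \<le> cmod (det V)"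
      unfolding dW_def V_def by (rule norm_det_power_mat_ge[OF kappa sep])
    also have "\<dots> = cmod (det W) * (\<Prod>j<n. cmod (?N j (z j)))"
      unfolding V by (simp add: det_mult[OF cm(2,3)] norm_mult det_R prod_norm)
    finally have det_W: "dW \<le> cmod (det W)" using N_pos by simp
    have Rx: "(R *\<^sub>v x) $ i = of_real (\<delta> ^ ?r i) * (U *\<^sub>v x) $ i"
      if "x \<in> carrier_vec n" "i < n" for x i
      using that \<delta> by (auto simp: R_def U_def scalar_prod_def sum_distrib_left intro!: sum.cong)
    have sqR: "sq_norm2 (R *\<^sub>v x) = (\<Sum>i<n. (\<delta> ^ ?r i)\<^sup>2 * (cmod ((U *\<^sub>v x) $ i))\<^sup>2)"
      if x: "x \<in> carrier_vec n" for x
    proof -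
      have "sq_norm2 (R *\<^sub>v x) = (\<Sum>i<n. (cmod ((R *\<^sub>v x) $ i))\<^sup>2)"
        by (rule sq_norm2_carrier) (use cm x in auto)
      also have "\<dots> = (\<Sum>i<n. (\<delta> ^ ?r i)\<^sup>2 * (cmod ((U *\<^sub>v x) $ i))\<^sup>2)"
        using \<delta> by (intro sum.cong refl) (simp add: Rx[OF x] norm_mult power_mult_distrib norm_power)
      finally show ?thesis .
    qed
    have Vx: "V *\<^sub>v x = W *\<^sub>v (R *\<^sub>v x)" if "x \<in> carrier_vec n" for x
      unfolding V by (rule assoc_mult_mat_vec[OF cm(2,3) that])
    have Rc: "R *\<^sub>v x \<in> carrier_vec n" if "x \<in> carrier_vec n" for x using cm that by auto
    have weaken: "s \<le> t * u \<Longrightarrow> t \<le> t' \<Longrightarrow> u \<ge> 0 \<Longrightarrow> s \<le> t' * u" for s t t' u :: real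
      by (meson mult_right_mono order_trans)
    \<comment> \<open>Increasing ranks give decreasing scales, since
      \<open>\<delta> \<le> 1\<close>.\<close>
    obtain p where p: "bij_betw p {..<n} {..<n}"
      "\<And>i j. i \<le> j \<Longrightarrow> j < n \<Longrightarrow> ?r (p i) \<le> ?r (p j)"
      using sort_key_permutation[of n ?r thesis] by blast
    obtain svs where "length svs = n" "mset svs = singular_values V"
      "\<And>k. k < n \<Longrightarrow> svs ! k \<ge> 0"
      "\<And>k. k < n \<Longrightarrow> svs ! k \<le> sqrt (a * b) * \<delta> ^ ?r (p k)"
      "\<And>k. k < n \<Longrightarrow> \<delta> ^ ?r (p k) \<le> sqrt (a * b) * svs ! k"
    proof (rule singular_values_compare[OF cm(1,4), where a = a and b = b and
            d = "\<lambda>i. \<delta> ^ ?r i" and p = p])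
      fix x :: "complex vec" assume x: "x \<in> carrier_vec n"
      show "sq_norm2 (V *\<^sub>v x) \<le> a * (\<Sum>i<n. (\<delta> ^ ?r i)\<^sup>2 * (cmod ((U *\<^sub>v x) $ i))\<^sup>2)"
        unfolding Vx[OF x] sqR[OF x, symmetric]
        by (rule weaken[OF sq_norm2_mult_le[OF cm(2) Rc[OF x] W_entry]])
           (use le in \<open>simp_all add: a1_def\<close>)
      show "(\<Sum>i<n. (\<delta> ^ ?r i)\<^sup>2 * (cmod ((U *\<^sub>v x) $ i))\<^sup>2) \<le> a * sq_norm2 (V *\<^sub>v x)"
        unfolding Vx[OF x] sqR[OF x, symmetric]
        by (rule weaken[OF sq_norm2_le_mult[OF cm(2) Rc[OF x] W_entry dW det_W]])
           (use le in \<open>simp_all add: a2_def\<close>)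
      show "sq_norm2 (U *\<^sub>v x) \<le> b * sq_norm2 x"
        by (rule weaken[OF sq_norm2_mult_le[OF cm(4) x U_entry]])
           (use le in \<open>simp_all add: b1_def\<close>)
      show "sq_norm2 x \<le> b * sq_norm2 (U *\<^sub>v x)"
      proof (rule weaken)
        show "sq_norm2 x \<le> b2 * sq_norm2 (U *\<^sub>v x)"
          unfolding b2_def by (rule sq_norm2_le_mult[OF cm(4) x U_entry]) (use det_U in auto)
      qed (use le in auto)
    next
      fix i j assume "i \<le> j" "j < n"
      thus "\<delta> ^ ?r (p j) \<le> \<delta> ^ ?r (p i)" using p(2) \<delta> by (intro power_decreasing) auto
    qed (use a b \<delta> p in auto)
    thus "\<exists>svs p. bij_betw p {..<n} {..<n} \<and> length svs = n \<and>
         mset svs = singular_values (mat n n (\<lambda>(k, i). z i ^ k)) \<and>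
         (\<forall>k<n. svs ! k \<le> sqrt (a * b) * \<delta> ^ ?r (p k) \<and>
                \<delta> ^ ?r (p k) \<le> sqrt (a * b) * svs ! k)"
      using p(1) unfolding V_def by blast
  qed
qed

subsection \<open>Nodes on the unit circle\<close>

text \<open>The function \<open>sin t - t * cos t\<close> is nondecreasing on the interval from 0 to
  \<open>x / 2\<close>, as its derivative is \<open>t * sin t\<close>. With the double-angle
  formulas this gives \<open>sin x \<ge> x * (cos (x / 2))\<^sup>2\<close>, and the squared cosine
  is at least 1/2 because \<open>cos x \<ge> 0\<close>.\<close>

lemma sin_ge_half:
  assumes "0 \<le> x" "x \<le> pi / 2"
  shows "x / 2 \<le> sin (x :: real)"
proof -
  have deriv: "((\<lambda>t. sin t - t * cos t) has_real_derivative t * sin t) (at t)" for t :: real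
    by (auto intro!: derivative_eq_intros)
  have "0 - 0 * cos (0 :: real) \<le> sin (x / 2) - x / 2 * cos (x / 2)"
    using DERIV_nonneg_imp_nondecreasing[of 0 "x / 2" "\<lambda>t. sin t - t * cos t"] assms
    by (force intro!: exI[of _ "_ * sin _"] deriv mult_nonneg_nonneg sin_ge_zero)
  hence "x / 2 * cos (x / 2) \<le> sin (x / 2)" by simp
  moreover have "cos (x / 2) \<ge> 0" using assms by (intro cos_ge_zero) auto
  ultimately have "x / 2 * cos (x / 2) * cos (x / 2) \<le> sin (x / 2) * cos (x / 2)"
    by (rule mult_right_mono)
  hence "x * (cos (x / 2))\<^sup>2 \<le> sin x"
    using sin_double[of "x / 2"] by (simp add: power2_eq_square)
  moreover have "(cos (x / 2))\<^sup>2 \<ge> 1 / 2"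
    using cos_double_cos[of "x / 2"] cos_ge_zero[of x] assms by simp
  hence "x * (1 / 2) \<le> x * (cos (x / 2))\<^sup>2"
    using assms by (intro mult_left_mono) auto
  ultimately show ?thesis by simp
qed

lemma norm_cis_diff: "cmod (cis x - cis y) = 2 * \<bar>sin ((x - y) / 2)\<bar>"
proof -
  have cos_xy: "cos (x - y) = 1 - 2 * (sin ((x - y) / 2))\<^sup>2"
    unfolding cos_double_sin[symmetric] by (rule arg_cong[of _ _ cos]) simp
  have "(cmod (cis x - cis y))\<^sup>2 = (cos x - cos y)\<^sup>2 + (sin x - sin y)\<^sup>2"
    by (simp add: cmod_power2)
  also have "\<dots> = ((sin x)\<^sup>2 + (cos x)\<^sup>2) + ((sin y)\<^sup>2 + (cos y)\<^sup>2) - 2 * (cos x * cos y + sin x * sin y)"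
    by (simp add: power2_eq_square algebra_simps)
  also have "\<dots> = 2 - 2 * cos (x - y)" by (simp add: cos_diff)
  also have "\<dots> = (2 * \<bar>sin ((x - y) / 2)\<bar>)\<^sup>2"
    unfolding cos_xy by (simp add: power_mult_distrib)
  finally show ?thesis by (rule power2_eq_imp_eq) auto
qed

lemma norm_cis_diff_le: "cmod (cis x - cis y) \<le> \<bar>x - y\<bar>"
  using abs_sin_x_le_abs_x[of "(x - y) / 2"] by (simp add: norm_cis_diff)

text \<open>The chord formula halves the angle, so an arc up to \<open>pi\<close> stays in the range
  of \<open>sin_ge_half\<close>.\<close>

lemma norm_cis_diff_ge:
  assumes "\<bar>x - y\<bar> \<le> pi"
  shows "\<bar>x - y\<bar> / 2 \<le> cmod (cis x - cis y)"
proof -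
  have "\<bar>(x - y) / 2\<bar> / 2 \<le> sin \<bar>(x - y) / 2\<bar>" using assms by (intro sin_ge_half) auto
  also have "\<dots> \<le> \<bar>sin ((x - y) / 2)\<bar>" by (simp add: abs_if)
  finally show ?thesis by (simp add: norm_cis_diff)
qed

text \<open>Differences of nodes from \<open>{- (pi / 2)<..pi / 2}\<close> satisfy the hypothesis,
  so no wrap-around occurs between them.\<close>

lemma torus_norm_eq_abs:
  assumes "\<bar>x\<bar> < pi"
  shows "torus_norm x = \<bar>x\<bar>"
proof -
  have "Arg (cis x) = x" using assms by (intro cis_Arg_unique) (auto simp: sgn_eq)
  thus ?thesis by (simp add: torus_norm_def cis_conv_exp)
qed

section \<open>Passing from node sets to indexed nodes with cluster labels\<close>

lemma vandermonde_eq_power_mat: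
  assumes "card X = n"
  shows "vandermonde X {0..int n - 1} = mat n n (\<lambda>(k, i). cis (sorted_list_of_set X ! i) ^ k)"
proof -
  have "int ` {0..<n} = {0..int n - 1}"
    using image_int_atLeastLessThan[of 0 n] by (simp add: atLeastLessThanPlusOne_atLeastAtMost_int[symmetric])
  hence "sorted_list_of_set {0..int n - 1} = map int [0..<n]"
    using sorted_list_of_set.idem_if_sorted_distinct[of "map int [0..<n]"]
    by (simp add: distinct_map sorted_map inj_on_def strict_sorted_iff)
  thus ?thesis using assms
    by (intro eq_matI) (auto simp: vandermonde_def DeMoivre cis_conv_exp mult_ac exp_of_nat_mult[symmetric])
qed

lemma min_separation_bounds:
  assumes X: "finite X" "X \<subseteq> {- (pi / 2)<..pi / 2}" "2 \<le> card X"
  shows "0 < min_separation X" "min_separation X < pi"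
proof -
  let ?S = "{torus_norm (x - y) | x y. x \<in> X \<and> y \<in> X \<and> x \<noteq> y}"
  have "?S \<subseteq> (\<lambda>(x, y). torus_norm (x - y)) ` (X \<times> X)" by auto
  hence fin: "finite ?S" by (rule finite_subset) (use X in auto)
  have "\<not> card X \<le> 1" using X by simp
  then obtain x y where xy: "x \<in> X" "y \<in> X" "x \<noteq> y"
    using X by (auto simp: card_le_Suc0_iff_eq)
  hence ne: "?S \<noteq> {}" by auto
  have "t > 0 \<and> t < pi" if t: "t \<in> ?S" for t
  proof -
    obtain x y where *: "t = torus_norm (x - y)" "x \<in> X" "y \<in> X" "x \<noteq> y" using t by auto
    hence "\<bar>x - y\<bar> < pi" using subsetD[OF X(2) *(2)] subsetD[OF X(2) *(3)] by auto
    thus ?thesis using * torus_norm_eq_abs by auto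
  qed
  with Min_in[OF fin ne] show "0 < min_separation X" "min_separation X < pi"
    by (auto simp: min_separation_def)
qed

text \<open>The label of an index is the number of the block that contains its node; disjointness
  makes it unique, so each label occurs as often as its block has nodes.\<close>

lemma clustered_configuration_labels:
  fixes X :: "real set"
  defines "xs \<equiv> sorted_list_of_set X"
  assumes X: "finite X" "card X = n" and conf: "clustered_configuration M h \<nu> q \<eta> X"
  obtains cl where
    "\<And>i. i < n \<Longrightarrow> cl i \<in> {1..M}"
    "\<And>a. a \<in> {1..M} \<Longrightarrow> card {i. i < n \<and> cl i = a} = q a"
    "\<And>i j. i < n \<Longrightarrow> j < n \<Longrightarrow> i \<noteq> j \<Longrightarrow> cl i = cl j \<Longrightarrow> h (cl i) \<le> torus_norm (xs ! i - xs ! j)"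
    "\<And>i j. i < n \<Longrightarrow> j < n \<Longrightarrow> i \<noteq> j \<Longrightarrow> cl i = cl j \<Longrightarrow>
       torus_norm (xs ! i - xs ! j) \<le> \<nu> (cl i) * h (cl i)"
    "\<And>i j. i < n \<Longrightarrow> j < n \<Longrightarrow> cl i \<noteq> cl j \<Longrightarrow> \<eta> \<le> torus_norm (xs ! i - xs ! j)"
proof -
  obtain C where C: "(\<Union>j\<in>{1..M}. C j) = X" "disjoint_family_on C {1..M}"
    "\<And>j. j \<in> {1..M} \<Longrightarrow> is_cluster (h j) (\<nu> j) (q j) (C j)"
    "\<And>j x y. j \<in> {1..M} \<Longrightarrow> x \<in> C j \<Longrightarrow> y \<in> X - C j \<Longrightarrow> torus_norm (x - y) \<ge> \<eta>"
    using conf unfolding clustered_configuration_def by blast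
  have len: "length xs = n" and dist: "distinct xs" and set: "set xs = X"
    using X by (auto simp: xs_def)
  have "\<forall>i\<in>{..<n}. \<exists>a. a \<in> {1..M} \<and> xs ! i \<in> C a"
    using C(1) len set nth_mem by blast
  then obtain cl where cl: "\<And>i. i < n \<Longrightarrow> cl i \<in> {1..M} \<and> xs ! i \<in> C (cl i)"
    using bchoice[of "{..<n}" "\<lambda>i a. a \<in> {1..M} \<and> xs ! i \<in> C a"] by auto
  have cl_unique: "cl i = a" if "i < n" "a \<in> {1..M}" "xs ! i \<in> C a" for i a
    using C(2) cl[OF that(1)] that unfolding disjoint_family_on_def by blast
  show ?thesis
  proof (rule that[of cl])
    show "cl i \<in> {1..M}" if "i < n" for i using cl that by blast
    show "card {i. i < n \<and> cl i = a} = q a" if a: "a \<in> {1..M}" for a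
    proof -
      have "C a \<subseteq> (!) xs ` {i. i < n \<and> cl i = a}"
      proof
        fix x assume x: "x \<in> C a"
        hence "x \<in> set xs" using C(1) a set by blast
        then obtain i where "i < n" "xs ! i = x" using len by (auto simp: in_set_conv_nth)
        thus "x \<in> (!) xs ` {i. i < n \<and> cl i = a}" using cl_unique a x by blast
      qed
      hence "(!) xs ` {i. i < n \<and> cl i = a} = C a" using cl by auto
      moreover have "inj_on ((!) xs) {i. i < n \<and> cl i = a}"
        by (rule inj_on_nth) (use dist len in auto)
      ultimately have "card {i. i < n \<and> cl i = a} = card (C a)" by (metis card_image)
      thus ?thesis using C(3)[OF a] by (simp add: is_cluster_def)
    qed
    fix i j assume ij: "i < n" "j < n"
    {
      assume *: "i \<noteq> j" "cl i = cl j"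
      have "xs ! i \<noteq> xs ! j" using * ij dist len by (simp add: nth_eq_iff_index_eq)
      thus "h (cl i) \<le> torus_norm (xs ! i - xs ! j)"
        "torus_norm (xs ! i - xs ! j) \<le> \<nu> (cl i) * h (cl i)"
        using C(3)[of "cl i"] cl[OF ij(1)] cl[OF ij(2)] * unfolding is_cluster_def by metis+
    next
      assume "cl i \<noteq> cl j"
      hence "xs ! j \<in> X - C (cl i)"
        using cl_unique[OF ij(2)] cl[OF ij(1)] ij len set by (auto dest: nth_mem)
      thus "\<eta> \<le> torus_norm (xs ! i - xs ! j)" using C(4) cl[OF ij(1)] by blast
    }
  qed
qed

subsection \<open>Counting the scales\<close>

lemma image_rank_in_class:
  "rank_in_class cl ` {j. j < n \<and> cl j = a} = {..<card {j. j < n \<and> cl j = a}}"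
proof (rule card_subset_eq)
  show "rank_in_class cl ` {j. j < n \<and> cl j = a} \<subseteq> {..<card {j. j < n \<and> cl j = a}}"
    by (auto simp: rank_in_class_def intro!: psubset_card_mono)
  show "card (rank_in_class cl ` {j. j < n \<and> cl j = a}) = card {..<card {j. j < n \<and> cl j = a}}"
    by (subst card_image) (auto intro: inj_on_subset[OF inj_on_rank_in_class[of cl a]])
qed simp

text \<open>A class has exactly one member of rank \<open>r\<close> if it has more than
  \<open>r\<close> members, and none otherwise, so \<open>cl\<close> maps the indices of rank
  \<open>r\<close> bijectively onto such classes. With \<open>r = m - 1\<close> this counts the
  clusters with at least \<open>m\<close> nodes.\<close>

lemma card_rank_in_class_eq:
  assumes cl: "\<And>i. i < n \<Longrightarrow> cl i \<in> S"
    and q: "\<And>a. a \<in> S \<Longrightarrow> card {i. i < n \<and> cl i = a} = q a"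
  shows "card {j. j < n \<and> rank_in_class cl j = r} = card {a \<in> S. r < q a}"
proof -
  have "cl ` {j. j < n \<and> rank_in_class cl j = r} = {a \<in> S. r < q a}"
  proof (intro equalityI subsetI)
    fix a assume "a \<in> cl ` {j. j < n \<and> rank_in_class cl j = r}"
    then obtain j where j: "j < n" "rank_in_class cl j = r" "cl j = a" by auto
    hence "r \<in> rank_in_class cl ` {j. j < n \<and> cl j = a}" by auto
    moreover have "a \<in> S" using cl j by auto
    ultimately show "a \<in> {a \<in> S. r < q a}" unfolding image_rank_in_class by (simp add: q)
  next
    fix a assume "a \<in> {a \<in> S. r < q a}"
    hence "r \<in> rank_in_class cl ` {j. j < n \<and> cl j = a}" "a \<in> S"
      unfolding image_rank_in_class using q by auto
    thus "a \<in> cl ` {j. j < n \<and> rank_in_class cl j = r}" by auto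
  qed
  moreover have "inj_on cl {j. j < n \<and> rank_in_class cl j = r}"
  proof (rule inj_onI)
    fix i j assume "i \<in> {j. j < n \<and> rank_in_class cl j = r}" "cl i = cl j"
      "j \<in> {j. j < n \<and> rank_in_class cl j = r}"
    thus "i = j" using inj_onD[OF inj_on_rank_in_class, of cl i j "cl j"] by simp
  qed
  ultimately show ?thesis by (metis card_image)
qed

text \<open>Bijections from \<open>{1..l m}\<close> to the positions where \<open>f\<close> equals
  \<open>m - 1\<close> combine to an enumeration of all positions, because the values of
  \<open>f\<close> separate the groups. Groups are numbered from 1, values of \<open>f\<close> from
  0.\<close>

lemma mset_eq_image_mset_Sigma:
  fixes ys :: "'a list" and f :: "nat \<Rightarrow> nat"
  assumes f: "\<And>k. k < length ys \<Longrightarrow> f k < s"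
    and l: "\<And>m. m \<in> {1..s} \<Longrightarrow> l m = card {k. k < length ys \<and> f k = m - 1}"
  obtains \<sigma> where
    "mset ys = image_mset (\<lambda>(m, i). \<sigma> m i) (mset_set (SIGMA m:{1..s}. {1..l m}))"
    "\<And>m i. m \<in> {1..s} \<Longrightarrow> i \<in> {1..l m} \<Longrightarrow> \<exists>k<length ys. f k = m - 1 \<and> \<sigma> m i = ys ! k"
proof -
  let ?n = "length ys"
  let ?S = "SIGMA m:{1..s}. {1..l m}"
  have "\<forall>m\<in>{1..s}. \<exists>g. bij_betw g {1..l m} {k. k < ?n \<and> f k = m - 1}"
    by (intro ballI finite_same_card_bij) (auto simp: l)
  then obtain g where g: "\<And>m. m \<in> {1..s} \<Longrightarrow> bij_betw (g m) {1..l m} {k. k < ?n \<and> f k = m - 1}"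
    by (metis bchoice)
  have g_in: "g m i < ?n \<and> f (g m i) = m - 1" if "m \<in> {1..s}" "i \<in> {1..l m}" for m i
    using bij_betwE[OF g[OF that(1)]] that(2) by auto
  have inj: "inj_on (\<lambda>(m, i). g m i) ?S"
  proof (rule inj_onI, clarify)
    fix m i m' i' assume *: "m \<in> {1..s}" "i \<in> {1..l m}" "m' \<in> {1..s}" "i' \<in> {1..l m'}" "g m i = g m' i'"
    hence "m - 1 = m' - 1" using g_in by metis
    hence m: "m = m'" using * by auto
    moreover have "i = i'"
      using inj_onD[OF bij_betw_imp_inj_on[OF g[OF *(1)]], of i i'] * m by simp
    ultimately show "m = m' \<and> i = i'" by simp
  qed
  have img: "(\<lambda>(m, i). g m i) ` ?S = {..<?n}"
  proof (intro equalityI subsetI)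
    fix k assume "k \<in> {..<?n}"
    hence k: "k < ?n" by simp
    have m: "Suc (f k) \<in> {1..s}" using f[OF k] by auto
    hence "k \<in> g (Suc (f k)) ` {1..l (Suc (f k))}" using g[OF m] k by (simp add: bij_betw_def)
    thus "k \<in> (\<lambda>(m, i). g m i) ` ?S" using m by force
  qed (use g_in in auto)
  have "image_mset (\<lambda>(m, i). ys ! g m i) (mset_set ?S) =
      image_mset ((!) ys) (image_mset (\<lambda>(m, i). g m i) (mset_set ?S))"
    by (simp add: image_mset.compositionality comp_def case_prod_unfold)
  also have "\<dots> = image_mset ((!) ys) (mset_set {..<?n})"
    by (simp only: image_mset_mset_set[OF inj] img)
  also have "\<dots> = mset (map ((!) ys) [0..<?n])" by (simp add: atLeast0LessThan)
  also have "\<dots> = mset ys" by (simp only: map_nth)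
  finally show ?thesis using g_in by (intro that[of "\<lambda>m i. ys ! g m i"]) auto
qed

text \<open>The constants \<open>c\<close> and \<open>K\<close> are chosen before \<open>X\<close>
  and \<open>h\<close>, which expresses that they do not depend on the minimal separation.\<close>

theorem theorem4:
  fixes n M s :: nat and q l :: "nat \<Rightarrow> nat" and \<nu> :: "nat \<Rightarrow> real" and \<eta> :: real
  assumes "n \<ge> 1"
    and "s = Max (q ` {1..M})"
    and "\<And>m. l m = card {k \<in> {1..M}. m \<le> q k}"
  shows "\<exists>c > 0. \<exists>K > 0. \<forall>(X :: real set) (h :: nat \<Rightarrow> real).
           finite X \<and> card X = n \<and> X \<subseteq> {- (pi / 2) <.. pi / 2} \<and>
           clustered_configuration M h \<nu> q \<eta> X \<and>
           (\<forall>j\<in>{1..M}. h j = min_separation X) \<longrightarrow>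
           (\<exists>\<sigma> :: nat \<Rightarrow> nat \<Rightarrow> real.
              singular_values (vandermonde X {0..int n - 1}) =
                image_mset (\<lambda>(m, i). \<sigma> m i) (mset_set (SIGMA m:{1..s}. {1..l m})) \<and>
              (\<forall>m\<in>{1..s}. \<forall>i\<in>{1..l m}.
                 c * min_separation X ^ (m - 1) \<le> \<sigma> m i \<and>
                 \<sigma> m i \<le> K * min_separation X ^ (m - 1)))"
proof (cases "\<eta> > 0")
  case False
  \<comment> \<open>A clustered configuration requires \<open>\<eta> > 0\<close>, so the claim is
    vacuous and any positive constants serve.\<close>
  thus ?thesis
    by (intro exI[of _ "1 :: real"] conjI zero_less_one) (auto simp: clustered_configuration_def)
next
  case \<eta>: True
  \<comment> \<open>A chord is at least half its arc, so nodes of different clusters are at least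
    \<open>\<eta> / 2\<close> apart on the circle. In \<open>L\<close> the factor 4 compensates for
    the choice of \<open>\<delta>\<close> as a quarter of \<open>\<Delta>\<close> below, and the sum
    dominates every single \<open>\<nu> j\<close>.\<close>
  define \<kappa> where "\<kappa> = min 1 (\<eta> / 2)"
  define L where "L = 1 + 4 * (\<Sum>j\<in>{1..M}. \<bar>\<nu> j\<bar>)"
  have \<kappa>: "0 < \<kappa>" "\<kappa> \<le> 1" using \<eta> by (auto simp: \<kappa>_def)
  have L: "L \<ge> 1" by (simp add: L_def sum_nonneg)
  have \<nu>L: "4 * \<nu> j \<le> L" if "j \<in> {1..M}" for j
    using member_le_sum[of j "{1..M}" "\<lambda>j. \<bar>\<nu> j\<bar>"] that by (simp add: L_def)
  obtain C where C: "C > 0" and sv: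
    "\<And>(z :: nat \<Rightarrow> complex) (cl :: nat \<Rightarrow> nat) \<delta>.
       \<lbrakk>\<And>i. cmod (z i) \<le> 1; 0 < \<delta>; \<delta> \<le> 1;
        \<And>i j. i < n \<Longrightarrow> j < n \<Longrightarrow> i \<noteq> j \<Longrightarrow> cl i = cl j \<Longrightarrow> \<delta> \<le> cmod (z i - z j);
        \<And>i j. i < n \<Longrightarrow> j < n \<Longrightarrow> i \<noteq> j \<Longrightarrow> cl i = cl j \<Longrightarrow> cmod (z i - z j) \<le> L * \<delta>;
        \<And>i j. i < n \<Longrightarrow> j < n \<Longrightarrow> cl i \<noteq> cl j \<Longrightarrow> \<kappa> \<le> cmod (z i - z j)\<rbrakk> \<Longrightarrow>
       \<exists>svs p. bij_betw p {..<n} {..<n} \<and> length svs = n \<and>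
         mset svs = singular_values (mat n n (\<lambda>(k, i). z i ^ k)) \<and>
         (\<forall>k<n. svs ! k \<le> C * \<delta> ^ rank_in_class cl (p k) \<and>
                \<delta> ^ rank_in_class cl (p k) \<le> C * svs ! k)"
    using singular_values_power_mat_clusters[OF \<kappa> L, of n thesis, where 'b = nat] by blast
  show ?thesis
  \<comment> \<open>The factor \<open>4 ^ n\<close> in the lower constant pays for replacing powers
    of \<open>\<Delta> / 4\<close> by powers of \<open>\<Delta>\<close>.\<close>
  proof (rule exI[of _ "1 / (C * 4 ^ n)"], intro conjI, use C in simp,
      rule exI[of _ C], intro conjI C allI impI)
    fix X :: "real set" and h :: "nat \<Rightarrow> real"
    define \<Delta> where "\<Delta> = min_separation X"
    assume "finite X \<and> card X = n \<and> X \<subseteq> {- (pi / 2) <.. pi / 2} \<and>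
      clustered_configuration M h \<nu> q \<eta> X \<and> (\<forall>j\<in>{1..M}. h j = min_separation X)"
    hence X: "finite X" "card X = n" "X \<subseteq> {- (pi / 2) <.. pi / 2}"
      and conf: "clustered_configuration M h \<nu> q \<eta> X" and h: "\<And>j. j \<in> {1..M} \<Longrightarrow> h j = \<Delta>"
      by (auto simp: \<Delta>_def)
    define xs where "xs = sorted_list_of_set X"
    define z where "z i = cis (xs ! i)" for i
    obtain cl where cl: "\<And>i. i < n \<Longrightarrow> cl i \<in> {1..M}"
      "\<And>a. a \<in> {1..M} \<Longrightarrow> card {i. i < n \<and> cl i = a} = q a"
      "\<And>i j. i < n \<Longrightarrow> j < n \<Longrightarrow> i \<noteq> j \<Longrightarrow> cl i = cl j \<Longrightarrow> h (cl i) \<le> torus_norm (xs ! i - xs ! j)"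
      "\<And>i j. i < n \<Longrightarrow> j < n \<Longrightarrow> i \<noteq> j \<Longrightarrow> cl i = cl j \<Longrightarrow>
         torus_norm (xs ! i - xs ! j) \<le> \<nu> (cl i) * h (cl i)"
      "\<And>i j. i < n \<Longrightarrow> j < n \<Longrightarrow> cl i \<noteq> cl j \<Longrightarrow> \<eta> \<le> torus_norm (xs ! i - xs ! j)"
      using clustered_configuration_labels[OF X(1,2) conf, folded xs_def, of thesis] by blast
    have xsX: "xs ! i \<in> X" if "i < n" for i
      using X that nth_mem[of i xs] by (simp add: xs_def)
    have dist_lt: "\<bar>xs ! i - xs ! j\<bar> < pi" if "i < n" "j < n" for i j
      using subsetD[OF X(3) xsX[OF that(1)]] subsetD[OF X(3) xsX[OF that(2)]] by auto
    have z_le: "cmod (z i - z j) \<le> torus_norm (xs ! i - xs ! j)" if "i < n" "j < n" for i j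
      using torus_norm_eq_abs[OF dist_lt[OF that]] norm_cis_diff_le[of "xs ! i" "xs ! j"]
      by (simp add: z_def)
    have z_ge: "torus_norm (xs ! i - xs ! j) / 2 \<le> cmod (z i - z j)" if "i < n" "j < n" for i j
      using torus_norm_eq_abs[OF dist_lt[OF that]] norm_cis_diff_ge[of "xs ! i" "xs ! j"]
        dist_lt[OF that] by (simp add: z_def)
    have z_norm: "cmod (z i) \<le> 1" for i by (simp add: z_def)
    have sep: "\<kappa> \<le> cmod (z i - z j)" if "i < n" "j < n" "cl i \<noteq> cl j" for i j
      using cl(5)[OF that] z_ge[OF that(1,2)] by (simp add: \<kappa>_def)
    obtain \<delta> where \<delta>: "0 < \<delta>" "\<delta> \<le> 1"
      and lo: "\<And>i j. i < n \<Longrightarrow> j < n \<Longrightarrow> i \<noteq> j \<Longrightarrow> cl i = cl j \<Longrightarrow> \<delta> \<le> cmod (z i - z j)"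
      and up: "\<And>i j. i < n \<Longrightarrow> j < n \<Longrightarrow> i \<noteq> j \<Longrightarrow> cl i = cl j \<Longrightarrow> cmod (z i - z j) \<le> L * \<delta>"
      and \<delta>\<Delta>: "\<And>e. e < n \<Longrightarrow> \<Delta> ^ e / 4 ^ n \<le> \<delta> ^ e" "\<And>e. e < n \<Longrightarrow> \<delta> ^ e \<le> \<Delta> ^ e"
    proof (cases "n = 1")
      case True
      \<comment> \<open>Here \<open>\<Delta>\<close> is the unspecified \<open>Min {}\<close>, but only its power \<open>0\<close> occurs.\<close>
      thus ?thesis by (intro that[of 1]) auto
    next
      case False
      hence "2 \<le> card X" using assms(1) X by simp
      note \<Delta> = min_separation_bounds[OF X(1,3) this, folded \<Delta>_def]
      show ?thesis
      \<comment> \<open>Since \<open>\<Delta> < pi < 4\<close>, the quotient is at most 1, and it is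
        below the chord bound \<open>\<Delta> / 2\<close>.\<close>
      proof (rule that[of "\<Delta> / 4"])
        show "0 < \<Delta> / 4" "\<Delta> / 4 \<le> 1" using \<Delta> pi_less_4 by auto
        fix i j assume ij: "i < n" "j < n" "i \<noteq> j" "cl i = cl j"
        show "\<Delta> / 4 \<le> cmod (z i - z j)"
          using cl(3)[OF ij] z_ge[OF ij(1,2)] h[OF cl(1)[OF ij(1)]] \<Delta> by simp
        have "\<nu> (cl i) * \<Delta> \<le> L * (\<Delta> / 4)"
          using mult_right_mono[OF \<nu>L[OF cl(1)[OF ij(1)]], of "\<Delta> / 4"] \<Delta> by simp
        thus "cmod (z i - z j) \<le> L * (\<Delta> / 4)"
          using cl(4)[OF ij] z_le[OF ij(1,2)] h[OF cl(1)[OF ij(1)]] by simp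
      next
        fix e assume "e < n"
        hence "(4 :: real) ^ e \<le> 4 ^ n" by (intro power_increasing) auto
        thus "\<Delta> ^ e / 4 ^ n \<le> (\<Delta> / 4) ^ e"
          unfolding power_divide using \<Delta> by (intro divide_left_mono) auto
        show "(\<Delta> / 4) ^ e \<le> \<Delta> ^ e" using \<Delta> by (intro power_mono) auto
      qed
    qed
    let ?r = "rank_in_class cl"
    obtain svs p where p: "bij_betw p {..<n} {..<n}" and len: "length svs = n"
      and svs: "mset svs = singular_values (mat n n (\<lambda>(k, i). z i ^ k))"
      and bounds: "\<And>k. k < n \<Longrightarrow> svs ! k \<le> C * \<delta> ^ ?r (p k)"
        "\<And>k. k < n \<Longrightarrow> \<delta> ^ ?r (p k) \<le> C * svs ! k"
      using sv[where z = z and \<delta> = \<delta> and cl = cl, OF z_norm \<delta> lo up sep] by blast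
    have p_lt: "p k < n" if "k < n" for k using bij_betwE[OF p] that by auto
    have r_lt: "?r j < q (cl j)" if "j < n" for j
    proof -
      have "?r j \<in> ?r ` {i. i < n \<and> cl i = cl j}" using that by auto
      thus ?thesis unfolding image_rank_in_class using cl(2)[OF cl(1)[OF that]] by simp
    qed
    have r_lt_s: "?r (p k) < s" if "k < length svs" for k
    proof -
      have "q (cl (p k)) \<le> s" unfolding assms(2)
        using cl(1)[OF p_lt[of k]] that len by (intro Max_ge) auto
      thus ?thesis using r_lt[of "p k"] p_lt[of k] that len by simp
    qed
    have l: "l m = card {k. k < length svs \<and> ?r (p k) = m - 1}" if m: "m \<in> {1..s}" for m
    proof -
      have "{k \<in> {1..M}. m \<le> q k} = {k \<in> {1..M}. m - 1 < q k}" using m by auto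
      hence "l m = card {j. j < n \<and> ?r j = m - 1}"
        using card_rank_in_class_eq[of n cl "{1..M}" q "m - 1"] cl(1,2) by (simp add: assms(3))
      \<comment> \<open>\<open>k\<close> numbers singular values in sorted order and
        \<open>j\<close> numbers nodes; the permutation \<open>p\<close> carries the count from one
        to the other.\<close>
      also have "p ` {k. k < n \<and> ?r (p k) = m - 1} = {j. j < n \<and> ?r j = m - 1}"
        using p by (auto simp: bij_betw_def)
      hence "card {j. j < n \<and> ?r j = m - 1} = card (p ` {k. k < n \<and> ?r (p k) = m - 1})" by simp
      also have "\<dots> = card {k. k < n \<and> ?r (p k) = m - 1}"
        using p by (intro card_image) (auto simp: bij_betw_def inj_on_def)
      finally show ?thesis by (simp add: len)
    qed
    obtain \<sigma> where \<sigma>: "mset svs = image_mset (\<lambda>(m, i). \<sigma> m i) (mset_set (SIGMA m:{1..s}. {1..l m}))"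
      "\<And>m i. m \<in> {1..s} \<Longrightarrow> i \<in> {1..l m} \<Longrightarrow>
         \<exists>k<length svs. ?r (p k) = m - 1 \<and> \<sigma> m i = svs ! k"
      using mset_eq_image_mset_Sigma[where f = "\<lambda>k. ?r (p k)" and ys = svs, OF r_lt_s l, of thesis] by blast
    have "1 / (C * 4 ^ n) * \<Delta> ^ (m - 1) \<le> \<sigma> m i \<and> \<sigma> m i \<le> C * \<Delta> ^ (m - 1)"
      if mi: "m \<in> {1..s}" "i \<in> {1..l m}" for m i
    proof -
      obtain k where k: "k < n" "?r (p k) = m - 1" "\<sigma> m i = svs ! k" using \<sigma>(2)[OF mi] len by auto
      \<comment> \<open>A rank never exceeds its index, so the exponent stays below
        \<open>n\<close>, where the comparison of \<open>\<delta>\<close> with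
        \<open>\<Delta>\<close> is available.\<close>
      have "?r (p k) \<le> p k"
        using card_mono[of "{..<p k}" "{i. i < p k \<and> cl i = cl (p k)}"] by (auto simp: rank_in_class_def)
      hence m: "m - 1 < n" using k p_lt[of k] by simp
      have "\<Delta> ^ (m - 1) / 4 ^ n \<le> C * \<sigma> m i"
        using order_trans[OF \<delta>\<Delta>(1)[OF m]] bounds(2)[OF k(1)] k by simp
      moreover have "\<sigma> m i \<le> C * \<Delta> ^ (m - 1)"
        using order_trans[OF bounds(1)[OF k(1)]] mult_left_mono[OF \<delta>\<Delta>(2)[OF m], of C] C k by simp
      ultimately show ?thesis using C by (simp add: field_simps)
    qed
    moreover have "singular_values (vandermonde X {0..int n - 1}) = mset svs"
      unfolding svs vandermonde_eq_power_mat[OF X(2)] by (simp add: z_def xs_def)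
    ultimately show "\<exists>\<sigma> :: nat \<Rightarrow> nat \<Rightarrow> real.
        singular_values (vandermonde X {0..int n - 1}) =
          image_mset (\<lambda>(m, i). \<sigma> m i) (mset_set (SIGMA m:{1..s}. {1..l m})) \<and>
        (\<forall>m\<in>{1..s}. \<forall>i\<in>{1..l m}.
           1 / (C * 4 ^ n) * min_separation X ^ (m - 1) \<le> \<sigma> m i \<and>
           \<sigma> m i \<le> C * min_separation X ^ (m - 1))"
      unfolding \<Delta>_def using \<sigma>(1) by (intro exI[of _ \<sigma>]) auto
  qed
qed

end
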